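(* There exist infinitely many pairwise non-isomorphic indecomposable torsionfree classical crystallographic groups with holonomy group isomorphic to the alternating group $A_4$ of degree $4$.
   Context: Let $G$ be a finite group and $M$ a $\mathbb{Z}G$-module which is free of finite rank as a $\mathbb{Z}$-module and on which $G$ acts faithfully. Let $\mathbb{R}M=\mathbb{R}\otimes_{\mathbb{Z}}M$, regarded as containing $M$ as a full lattice, with the induced linear action of $G$, and let $\widehat{M}=\mathbb{R}M/M$ be the quotient of additive groups with action $g(x+M)=g(x)+M$. A $1$-cocycle is a map $T:G\to\widehat{M}$ with $T(gh)=gT(h)+T(g)$ for all $g,h\in G$; it is a coboundary (cohomologous to $0$) if there is $z\in\widehat{M}$ with $T(g)=(g-1)z$ for all $g\in G$. Regarding each value $T(g)$ (a coset of $M$) as a subset of $\mathbb{R}M$, define the group $$\mathfrak{Crys}(G;M;T)=\{(g,x)\mid g\in G,\ x\in T(g)\},\qquad (g,x)(g',x')=(gg',\,gx'+x).$$ A classical crystallographic group with holonomy group $G$ is (up to isomorphism) a group of this form; its dimension is the $\mathbb{Z}$-rank of $M$. When $T$ is not cohomologous to $0$, the group $\mathfrak{Crys}(G;M;T)$ is called indecomposable if $M$ is an indecomposable $\mathbb{Z}G$-module. Torsionfree means that the group has no nontrivial element of finite order. *)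

theory Defs
  imports "HOL-Algebra.Sym_Groups" "HOL-Library.Set_Algebras" "HOL-Analysis.Finite_Function_Topology"
begin

definition int_span :: "'v::real_vector set \<Rightarrow> 'v set" where
  "int_span B = {(\<Sum>b\<in>B. of_int (c b) *\<^sub>R b) | c. True}"

text \<open>
  A \<open>\<int>G\<close>-module that is free of finite rank over \<open>\<int>\<close> is given as a lattice \<open>M\<close>, the integer span
  of a finite \<open>\<real>\<close>-linearly independent set of vectors in an ambient real vector space.  Then
  \<^term>\<open>span M\<close> is \<open>\<real> \<otimes> M\<close> with \<open>M\<close> a full lattice in it.  The map \<open>act\<close> is the \<open>\<real>\<close>-linear
  extension of the \<open>G\<close>-action to \<^term>\<open>span M\<close>; it is unconstrained outside \<^term>\<open>span M\<close>.
  With \<open>nat \<Rightarrow>\<^sub>0 real\<close> as ambient space, every module of this kind occurs up to isomorphism,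
  whatever its rank.
\<close>

locale faithful_lattice_module = group G
  for G :: "('g, 'a) monoid_scheme" (structure) +
  fixes M :: "'v::real_vector set" and act :: "'g \<Rightarrow> 'v \<Rightarrow> 'v"
  assumes finite_group: "finite (carrier G)"
    and lattice: "\<exists>B. finite B \<and> independent B \<and> M = int_span B"
    and act_lattice: "\<lbrakk>g \<in> carrier G; x \<in> M\<rbrakk> \<Longrightarrow> act g x \<in> M"
    and act_one: "x \<in> span M \<Longrightarrow> act \<one> x = x"
    and act_mult: "\<lbrakk>g \<in> carrier G; h \<in> carrier G; x \<in> span M\<rbrakk> \<Longrightarrow> act (g \<otimes> h) x = act g (act h x)"
    and act_add: "\<lbrakk>g \<in> carrier G; x \<in> span M; y \<in> span M\<rbrakk> \<Longrightarrow> act g (x + y) = act g x + act g y"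
    and act_scaleR: "\<lbrakk>g \<in> carrier G; x \<in> span M\<rbrakk> \<Longrightarrow> act g (r *\<^sub>R x) = r *\<^sub>R act g x"
    and faithful: "\<lbrakk>g \<in> carrier G; \<And>x. x \<in> M \<Longrightarrow> act g x = x\<rbrakk> \<Longrightarrow> g = \<one>"

definition submodule ::
    "('g, 'a) monoid_scheme \<Rightarrow> 'v::real_vector set \<Rightarrow> ('g \<Rightarrow> 'v \<Rightarrow> 'v) \<Rightarrow> 'v set \<Rightarrow> bool" where
  "submodule G M act N \<longleftrightarrow> N \<subseteq> M \<and> 0 \<in> N \<and> (\<forall>x\<in>N. \<forall>y\<in>N. x - y \<in> N) \<and>
     (\<forall>g\<in>carrier G. \<forall>x\<in>N. act g x \<in> N)"

definition indecomposable_module ::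
    "('g, 'a) monoid_scheme \<Rightarrow> 'v::real_vector set \<Rightarrow> ('g \<Rightarrow> 'v \<Rightarrow> 'v) \<Rightarrow> bool" where
  "indecomposable_module G M act \<longleftrightarrow> M \<noteq> {0} \<and>
     (\<forall>A B. submodule G M act A \<longrightarrow> submodule G M act B \<longrightarrow> A + B = M \<longrightarrow> A \<inter> B = {0} \<longrightarrow>
        A = {0} \<or> B = {0})"

text \<open>
  Elements of \<open>\<real>M/M\<close> are cosets \<^term>\<open>x +o M\<close> with \<^term>\<open>x \<in> span M\<close>.  Addition of cosets is addition
  of sets, and \<open>g\<close> sends the coset \<open>C\<close> to \<open>act g ` C\<close>.
\<close>

definition cocycle ::
    "('g, 'a) monoid_scheme \<Rightarrow> 'v::real_vector set \<Rightarrow> ('g \<Rightarrow> 'v \<Rightarrow> 'v) \<Rightarrow> ('g \<Rightarrow> 'v set) \<Rightarrow> bool" where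
  "cocycle G M act T \<longleftrightarrow>
     (\<forall>g\<in>carrier G. \<exists>x\<in>span M. T g = x +o M) \<and>
     (\<forall>g\<in>carrier G. \<forall>h\<in>carrier G. T (g \<otimes>\<^bsub>G\<^esub> h) = act g ` T h + T g)"

definition coboundary ::
    "('g, 'a) monoid_scheme \<Rightarrow> 'v::real_vector set \<Rightarrow> ('g \<Rightarrow> 'v \<Rightarrow> 'v) \<Rightarrow> ('g \<Rightarrow> 'v set) \<Rightarrow> bool" where
  "coboundary G M act T \<longleftrightarrow>
     (\<exists>z\<in>span M. \<forall>g\<in>carrier G. T g = (act g z - z) +o M)"

definition Crys ::
    "('g, 'a) monoid_scheme \<Rightarrow> ('g \<Rightarrow> 'v::real_vector \<Rightarrow> 'v) \<Rightarrow> ('g \<Rightarrow> 'v set) \<Rightarrow> ('g \<times> 'v) monoid" where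
  "Crys G act T =
     \<lparr>carrier = {(g, x). g \<in> carrier G \<and> x \<in> T g},
      mult = (\<lambda>(g, x) (h, y). (g \<otimes>\<^bsub>G\<^esub> h, act g y + x)),
      one = (\<one>\<^bsub>G\<^esub>, 0)\<rparr>"

definition indecomposable_crystallographic_group ::
    "('h, 'b) monoid_scheme \<Rightarrow> ('g \<times> 'v::real_vector) monoid \<Rightarrow> bool" where
  "indecomposable_crystallographic_group H \<Gamma> \<longleftrightarrow>
     (\<exists>(G :: 'g monoid) M act T.
        faithful_lattice_module G M act \<and> cocycle G M act T \<and> \<Gamma> = Crys G act T \<and> G \<cong> H \<and>
        \<not> coboundary G M act T \<and> indecomposable_module G M act)"

definition torsionfree :: "('c, 'd) monoid_scheme \<Rightarrow> bool" where
  "torsionfree \<Gamma> \<longleftrightarrow>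
     (\<forall>x\<in>carrier \<Gamma>. (\<exists>n::nat. n > 0 \<and> x [^]\<^bsub>\<Gamma>\<^esub> n = \<one>\<^bsub>\<Gamma>\<^esub>) \<longrightarrow> x = \<one>\<^bsub>\<Gamma>\<^esub>)"

lemma Crys_group:
  assumes "faithful_lattice_module G M act" "cocycle G M act T"
  shows "group (Crys G act T)"
proof -
  interpret faithful_lattice_module G M act by fact
  have cos: "\<exists>x\<in>span M. T g = x +o M" if "g \<in> carrier G" for g
    using assms(2) that unfolding cocycle_def by blast
  have coc: "T (g \<otimes>\<^bsub>G\<^esub> h) = act g ` T h + T g" if "g \<in> carrier G" "h \<in> carrier G" for g h
    using assms(2) that unfolding cocycle_def by blast
  obtain B where B: "M = int_span B" using lattice by blast
  have M0: "0 \<in> M"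
    unfolding B int_span_def by (auto intro!: exI[of _ "\<lambda>_. 0"])
  have Msub: "x - y \<in> M" if xy: "x \<in> M" "y \<in> M" for x y
  proof -
    obtain c d where "x = (\<Sum>b\<in>B. of_int (c b) *\<^sub>R b)" "y = (\<Sum>b\<in>B. of_int (d b) *\<^sub>R b)"
      using xy unfolding B int_span_def by auto
    then have "x - y = (\<Sum>b\<in>B. of_int (c b - d b) *\<^sub>R b)"
      by (simp add: sum_subtractf scaleR_diff_left)
    then show ?thesis
      unfolding B int_span_def by (intro CollectI exI[of _ "\<lambda>b. c b - d b"] conjI TrueI)
  qed
  have Tsp: "x \<in> span M" if "g \<in> carrier G" "x \<in> T g" for g x
    using cos[OF that(1)] that(2) span_add span_base by (fastforce simp: elt_set_plus_def)
  have Tdiff: "x - y \<in> M" if gxy: "g \<in> carrier G" "x \<in> T g" "y \<in> T g" for g x y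
  proof -
    obtain z a b where "x = z + a" "y = z + b" "a \<in> M" "b \<in> M"
      using cos[OF gxy(1)] gxy(2,3) by (auto simp: elt_set_plus_def)
    then show ?thesis using Msub by simp
  qed
  have Tne: "\<exists>x. x \<in> T g" if "g \<in> carrier G" for g
    using cos[OF that] M0 by (auto simp: elt_set_plus_def)
  have Tm: "x - m \<in> T g" if gxm: "g \<in> carrier G" "x \<in> T g" "m \<in> M" for g x m
  proof -
    obtain z a where z: "T g = z +o M" "x = z + a" "a \<in> M"
      using cos[OF gxm(1)] gxm(2) by (auto simp: elt_set_plus_def)
    have "x - m = z + (a - m)" using z by simp
    then show ?thesis using Msub[OF z(3) gxm(3)] z(1) by (auto simp: elt_set_plus_def)
  qed
  have clo: "act g y + x \<in> T (g \<otimes>\<^bsub>G\<^esub> h)" if "g \<in> carrier G" "h \<in> carrier G" "x \<in> T g" "y \<in> T h" for g h x y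
    using coc that by (auto simp: set_plus_def)
  have T1: "0 \<in> T \<one>\<^bsub>G\<^esub>"
  proof -
    obtain x where x: "x \<in> T \<one>\<^bsub>G\<^esub>" using Tne by blast
    have "act \<one>\<^bsub>G\<^esub> x + x \<in> T (\<one>\<^bsub>G\<^esub> \<otimes>\<^bsub>G\<^esub> \<one>\<^bsub>G\<^esub>)" using clo x by blast
    then have "x + x \<in> T \<one>\<^bsub>G\<^esub>" using act_one[OF Tsp[OF one_closed x]] by simp
    then have "(x + x) - x \<in> M" using Tdiff x one_closed by blast
    then have "x \<in> M" by simp
    then show ?thesis using Tm[OF one_closed x] by fastforce
  qed
  have actsp: "act g y \<in> span M" if gh: "g \<in> carrier G" "h \<in> carrier G" "y \<in> T h" for g h y
  proof -
    obtain x where x: "x \<in> T g" using Tne gh by blast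
    have "act g y + x \<in> span M" using clo[OF gh(1,2) x gh(3)] Tsp gh m_closed by blast
    then have "(act g y + x) - x \<in> span M" using Tsp gh x span_diff by blast
    then show ?thesis by simp
  qed
  show ?thesis
  proof (rule groupI)
    show "p \<otimes>\<^bsub>Crys G act T\<^esub> q \<in> carrier (Crys G act T)"
      if "p \<in> carrier (Crys G act T)" "q \<in> carrier (Crys G act T)" for p q
      using that clo by (auto simp: Crys_def)
    show "\<one>\<^bsub>Crys G act T\<^esub> \<in> carrier (Crys G act T)" using T1 by (auto simp: Crys_def)
    show "p \<otimes>\<^bsub>Crys G act T\<^esub> q \<otimes>\<^bsub>Crys G act T\<^esub> r = p \<otimes>\<^bsub>Crys G act T\<^esub> (q \<otimes>\<^bsub>Crys G act T\<^esub> r)"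
      if "p \<in> carrier (Crys G act T)" "q \<in> carrier (Crys G act T)" "r \<in> carrier (Crys G act T)" for p q r
      using that Tsp actsp by (auto simp: Crys_def act_mult[OF _ _ Tsp] act_add[OF _ actsp Tsp] m_assoc add.assoc)
    show "\<one>\<^bsub>Crys G act T\<^esub> \<otimes>\<^bsub>Crys G act T\<^esub> p = p" if "p \<in> carrier (Crys G act T)" for p
      using that by (auto simp: Crys_def act_one[OF Tsp])
    show "\<exists>q\<in>carrier (Crys G act T). q \<otimes>\<^bsub>Crys G act T\<^esub> p = \<one>\<^bsub>Crys G act T\<^esub>"
      if p: "p \<in> carrier (Crys G act T)" for p
    proof -
      obtain g x where g: "p = (g, x)" "g \<in> carrier G" "x \<in> T g" using p by (auto simp: Crys_def)
      obtain y where y: "y \<in> T (inv\<^bsub>G\<^esub> g)" using Tne g by blast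
      have "act (inv\<^bsub>G\<^esub> g) x + y \<in> T (inv\<^bsub>G\<^esub> g \<otimes>\<^bsub>G\<^esub> g)" using clo g y by blast
      then have "act (inv\<^bsub>G\<^esub> g) x + y \<in> T \<one>\<^bsub>G\<^esub>" using g by simp
      then have "act (inv\<^bsub>G\<^esub> g) x + y \<in> M" using Tdiff[OF one_closed _ T1] by fastforce
      then have "y - (act (inv\<^bsub>G\<^esub> g) x + y) \<in> T (inv\<^bsub>G\<^esub> g)" using Tm y g by blast
      then have "- act (inv\<^bsub>G\<^esub> g) x \<in> T (inv\<^bsub>G\<^esub> g)" by simp
      then show ?thesis using g by (intro bexI[of _ "(inv\<^bsub>G\<^esub> g, - act (inv\<^bsub>G\<^esub> g) x)"]) (auto simp: Crys_def)
    qed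
  qed
qed

end

theory Submission
  imports "HOL-Algebra.Multiplicative_Group" Defs
begin

text \<open>
  For every odd \<open>n\<close> there is a group as required whose translation lattice has rank \<open>6 * n\<close>.  The rank of
  the translation lattice is an isomorphism invariant, because the translations are exactly the
  elements that commute with all twelfth powers (\<open>translations_eq_centralizer\<close>); hence no two of these
  groups are isomorphic (\<open>iso_imp_rank_le\<close>).

  The lattices come from the Klein four-group \<open>V = {1, a, b, c}\<close>, which has indecomposable integral
  representations \<open>N\<close> of arbitrarily large rank.  Here \<open>N\<close> has a basis \<open>e\<^sub>0, \<dots>, e\<^bsub>n-1\<^esub>, f\<^sub>0, \<dots>, f\<^bsub>n-1\<^esub>\<close> on
  which, up to signs, \<open>a\<close> and \<open>b\<close> act by \<open>a e\<^sub>l = e\<^sub>l + f\<^sub>l\<close>, \<open>b e\<^sub>l = e\<^sub>l + f\<^bsub>l-1\<^esub>\<close> (where \<open>f\<^bsub>-1\<^esub> = 0\<close>), while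
  the \<open>f\<^sub>l\<close> are eigenvectors.  Modulo 2, the pair \<open>(a - 1, b - 1)\<close> is the pencil formed by the identity and
  a nilpotent Jordan block, and this is the reason for indecomposability.  The induced module \<open>L\<close> of
  the alternating group consists of three copies of \<open>N\<close> that an element of order 3 permutes, and in
  which the three involutions play the roles of \<open>a, b, c\<close> in rotated order.

  The module used is not \<open>L\<close>, but the submodule \<open>M\<close> of index 3 in which the weight, the sum of the
  \<open>e\<^sub>0\<close>-coordinates over the three copies, is divisible by 3.  As \<open>L\<close> is a free module over a subgroup
  of order 3, an extension by \<open>L\<close> always has 3-torsion.  On \<open>M\<close> the weight is an invariant functional with
  values in \<open>3\<int>\<close>, and the cocycle is chosen so that its weight is not in \<open>3\<int>\<close> on elements outside \<open>V\<close>;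
  such elements then cannot have finite order.  The involution that acts as \<open>b\<close> in some copy fixes the
  coordinate of the last \<open>f\<close> in that copy, and there the cocycle has the value \<open>1/2\<close>.  So an invariant
  functional also shows that elements over involutions have infinite order (\<open>torsionfree_crys\<close>).

  For indecomposability let \<open>p\<close> be the projection onto a direct summand.  The index 3 is invisible
  modulo 2, so that \<open>q = 3 p\<close> may be studied on all of \<open>L\<close>.  The vector \<open>e\<^sub>0\<close> of the first copy is, modulo 2
  and modulo the \<open>f\<^sub>l\<close>, the only nonzero one killed by the action of \<open>b - 1\<close>.  Therefore \<open>q\<close> maps it to 0 or to itself;
  after exchanging the two summands, to 0.  From \<open>(b - 1) e\<^bsub>l+1\<^esub> = (a - 1) e\<^sub>l\<close> one gets inductively that \<open>q\<close>
  kills all the \<open>e\<^sub>l\<close>, then all the \<open>f\<^sub>l\<close>, and by symmetry everything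
  (\<open>quasi_projection_trivial_mod_2\<close>).  Thus one of the summands lies in \<open>2 L\<close>, which makes it
  2-divisible and hence zero (\<open>summand_eq_0_if_even\<close>).
\<close>

section \<open>Ranks of lattices\<close>

lemma int_spanI: "(\<Sum>b\<in>B. of_int (c b) *\<^sub>R b) \<in> int_span B"
  by (auto simp: int_span_def)

lemma zero_int_span: "0 \<in> int_span B"
  using int_spanI[of "\<lambda>_. 0" B] by simp

lemma int_span_diff:
  assumes "x \<in> int_span B" "y \<in> int_span B"
  shows "x - y \<in> int_span B"
proof -
  obtain c d where "x = (\<Sum>b\<in>B. of_int (c b) *\<^sub>R b)" "y = (\<Sum>b\<in>B. of_int (d b) *\<^sub>R b)"
    using assms by (auto simp: int_span_def)
  then have "x - y = (\<Sum>b\<in>B. of_int (c b - d b) *\<^sub>R b)"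
    by (simp add: sum_subtractf scaleR_diff_left)
  then show ?thesis by (metis int_spanI)
qed

lemma int_span_superset: "finite B \<Longrightarrow> B \<subseteq> int_span B"
proof
  fix b assume "finite B" "b \<in> B"
  then have "b = (\<Sum>b'\<in>B. of_int (if b' = b then 1 else 0) *\<^sub>R b')"
    by (simp add: sum.remove[of B b] if_distrib[of "\<lambda>r. of_int r *\<^sub>R _"] cong: if_cong)
  then show "b \<in> int_span B" by (metis int_spanI)
qed

lemma int_span_subset_span: "int_span B \<subseteq> span B"
  by (auto simp: int_span_def intro!: span_sum intro: span_scale span_base)

lemma span_int_span: "finite B \<Longrightarrow> span (int_span B) = span B"
  by (metis int_span_subset_span int_span_superset span_eq span_superset subset_trans)

text \<open>
  An additive map on a lattice is the restriction of a linear map on its real span, so that the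
  comparison of ranks reduces to the exchange lemma for linearly independent sets.
\<close>
lemma rank_le_of_additive_surjection:
  fixes B :: "'v::real_vector set" and C :: "'w::real_vector set"
  assumes B: "finite B" "independent B" and C: "finite C" "independent C"
    and add: "\<And>x y. x \<in> int_span B \<Longrightarrow> y \<in> int_span B \<Longrightarrow> \<theta> (x + y) = \<theta> x + \<theta> y"
    and surj: "int_span C \<subseteq> \<theta> ` int_span B"
  shows "card C \<le> card B"
proof -
  have plus: "x + y \<in> int_span B" if "x \<in> int_span B" "y \<in> int_span B" for x y
    using int_span_diff[OF that(1) int_span_diff[OF zero_int_span that(2)]] by simp
  have zero: "\<theta> 0 = 0" using add[OF zero_int_span zero_int_span] by simp
  have minus: "\<theta> (- x) = - \<theta> x" "- x \<in> int_span B" if "x \<in> int_span B" for x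
  proof -
    show m: "- x \<in> int_span B" using int_span_diff[OF zero_int_span that] by simp
    have "\<theta> (x + - x) = \<theta> x + \<theta> (- x)" by (rule add[OF that m])
    then show "\<theta> (- x) = - \<theta> x" using zero by (simp add: eq_neg_iff_add_eq_0 add.commute)
  qed
  have nat: "\<theta> (of_nat k *\<^sub>R x) = of_nat k *\<^sub>R \<theta> x \<and> of_nat k *\<^sub>R x \<in> int_span B" if "x \<in> int_span B" for k x
    by (induction k) (use that zero zero_int_span plus add in \<open>auto simp: scaleR_add_left\<close>)
  have int: "\<theta> (of_int k *\<^sub>R x) = of_int k *\<^sub>R \<theta> x \<and> of_int k *\<^sub>R x \<in> int_span B" if "x \<in> int_span B" for k x
  proof (cases k)
    case (nonneg n)
    then show ?thesis using nat[OF that] by simp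
  next
    case (neg n)
    have k: "of_int k = - (of_nat (Suc n) :: real)" using neg by simp
    then show ?thesis
      using nat[OF that, of "Suc n"] minus[of "of_nat (Suc n) *\<^sub>R x"] unfolding k by (simp only: scaleR_minus_left)
  qed
  obtain f where f: "linear f" "\<forall>b\<in>B. f b = \<theta> b"
    using linear_independent_extend[OF B(2)] by blast
  have "f (\<Sum>b\<in>S. of_int (c b) *\<^sub>R b) = \<theta> (\<Sum>b\<in>S. of_int (c b) *\<^sub>R b) \<and>
      (\<Sum>b\<in>S. of_int (c b) *\<^sub>R b) \<in> int_span B" if "finite S" "S \<subseteq> B" for S c
    using that
  proof (induction S rule: finite_induct)
    case empty
    then show ?case using zero zero_int_span linear_0[OF f(1)] by simp
  next
    case (insert b S)
    then have b: "b \<in> B" "b \<in> int_span B" using int_span_superset[OF B(1)] by auto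
    then show ?case
      using insert int[OF b(2), of "c b"] add plus f by (simp add: linear_add linear_scale)
  qed
  then have "f x = \<theta> x" if "x \<in> int_span B" for x
    using that B(1) unfolding int_span_def by blast
  moreover have "int_span B \<subseteq> span B" by (rule int_span_subset_span)
  ultimately have "\<theta> ` int_span B \<subseteq> f ` span B" by force
  then have "int_span C \<subseteq> f ` span B" using surj by (rule subset_trans[rotated])
  then have "C \<subseteq> span (f ` B)"
    using int_span_superset[OF C(1)] linear_span_image[OF f(1)] by blast
  then have "card C \<le> card (f ` B)"
    using independent_span_bound[of "f ` B" C] C B(1) by simp
  also have "\<dots> \<le> card B" using B(1) by (rule card_image_le)
  finally show ?thesis .
qed

section \<open>Crystallographic groups and their translations\<close>
locale crystallographic = faithful_lattice_module G M act
  for G :: "('g, 'a) monoid_scheme" (structure) and M :: "'v::real_vector set" and act +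
  fixes T :: "'g \<Rightarrow> 'v set"
  assumes cocycle: "cocycle G M act T"
begin

abbreviation "\<Gamma> \<equiv> Crys G act T"

lemma group_\<Gamma>: "group \<Gamma>"
  using Crys_group faithful_lattice_module_axioms cocycle by blast

lemma zero_M: "0 \<in> M"
  using lattice zero_int_span by blast

lemma diff_M: "x \<in> M \<Longrightarrow> y \<in> M \<Longrightarrow> x - y \<in> M"
  using lattice int_span_diff by blast

lemma minus_M: "x \<in> M \<Longrightarrow> - x \<in> M"
  using diff_M[OF zero_M, of x] by simp

lemma add_M: "x \<in> M \<Longrightarrow> y \<in> M \<Longrightarrow> x + y \<in> M"
  using diff_M[OF _ minus_M, of x y] by simp

lemma T_coset: "g \<in> carrier G \<Longrightarrow> \<exists>x\<in>span M. T g = x +o M"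
  using cocycle unfolding cocycle_def by blast

lemma T_span: "g \<in> carrier G \<Longrightarrow> x \<in> T g \<Longrightarrow> x \<in> span M"
  using T_coset[of g] by (auto simp: elt_set_plus_def intro!: span_add intro: span_base)

lemma T_one: "T \<one> = M"
proof -
  have "\<one>\<^bsub>\<Gamma>\<^esub> \<in> carrier \<Gamma>" using group_\<Gamma> by (simp add: group.is_monoid)
  then have 0: "0 \<in> T \<one>" by (simp add: Crys_def)
  obtain z where z: "T \<one> = z +o M" using T_coset[OF one_closed] by blast
  then obtain m where m: "m \<in> M" "0 = z + m" using 0 by (auto simp: elt_set_plus_def)
  have "z = - m" using m(2) by (simp add: eq_neg_iff_add_eq_0)
  then have zM: "z \<in> M" using m(1) minus_M by simp
  show ?thesis
  proof
    show "T \<one> \<subseteq> M" using z zM add_M by (auto simp: elt_set_plus_def)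
    show "M \<subseteq> T \<one>"
    proof
      fix x assume "x \<in> M"
      then have "x - z \<in> M" "x = z + (x - z)" using zM diff_M by auto
      then show "x \<in> T \<one>" unfolding z unfolding elt_set_plus_def by blast
    qed
  qed
qed

lemma one_\<Gamma>: "\<one>\<^bsub>\<Gamma>\<^esub> = (\<one>, 0)"
  and mult_\<Gamma>: "(g, x) \<otimes>\<^bsub>\<Gamma>\<^esub> (h, y) = (g \<otimes> h, act g y + x)"
  and carrier_\<Gamma>: "(g, x) \<in> carrier \<Gamma> \<longleftrightarrow> g \<in> carrier G \<and> x \<in> T g"
  by (simp_all add: Crys_def)

lemma translation_in_\<Gamma>: "x \<in> M \<Longrightarrow> (\<one>, x) \<in> carrier \<Gamma>"
  by (simp add: carrier_\<Gamma> T_one)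

text \<open>
  A functional that is invariant under \<open>g\<close> does not see the twist in the multiplication, so it behaves
  on powers of \<open>(g, x)\<close> like a homomorphism.  All the arguments about torsion rest on this.
\<close>
lemma pow_\<Gamma>:
  assumes "(g, x) \<in> carrier \<Gamma>"
  shows "\<exists>y. (g, x) [^]\<^bsub>\<Gamma>\<^esub> (k::nat) = (g [^] k, y) \<and> y \<in> T (g [^] k) \<and>
    (\<forall>\<psi>. linear \<psi> \<longrightarrow> (\<forall>z\<in>span M. \<psi> (act g z) = \<psi> z) \<longrightarrow> \<psi> y = of_nat k *\<^sub>R (\<psi> x :: 'w::real_vector))"
proof (induction k)
  case 0
  then show ?case by (auto simp: one_\<Gamma> T_one zero_M linear_0 Group.nat_pow_def)
next
  case (Suc k)
  interpret \<Gamma>: group \<Gamma> by (rule group_\<Gamma>)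
  have g: "g \<in> carrier G" using assms carrier_\<Gamma> by blast
  from Suc obtain y where y: "(g, x) [^]\<^bsub>\<Gamma>\<^esub> k = (g [^] k, y)" "y \<in> T (g [^] k)"
    "\<And>\<psi>. linear \<psi> \<Longrightarrow> \<forall>z\<in>span M. \<psi> (act g z) = \<psi> z \<Longrightarrow> \<psi> y = of_nat k *\<^sub>R (\<psi> x :: 'w)" by blast
  have eq: "(g, x) [^]\<^bsub>\<Gamma>\<^esub> Suc k = (g [^] Suc k, act g y + x)"
    using \<Gamma>.nat_pow_Suc2[OF assms, of k] nat_pow_Suc2[OF g, of k] y(1) by (simp add: mult_\<Gamma>)
  moreover have "act g y + x \<in> T (g [^] Suc k)"
    using \<Gamma>.nat_pow_closed[OF assms, of "Suc k"] unfolding eq carrier_\<Gamma> by blast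
  moreover have "\<psi> (act g y + x) = of_nat (Suc k) *\<^sub>R (\<psi> x :: 'w)"
    if "linear \<psi>" "\<forall>z\<in>span M. \<psi> (act g z) = \<psi> z" for \<psi>
    using that y(2) y(3)[OF that] T_span[of "g [^] k" y] g
    by (simp add: linear_add scaleR_add_left)
  ultimately show ?case by blast
qed

lemma infinite_order_if_invariant_functional:
  fixes \<psi> :: "'v \<Rightarrow> real"
  assumes "(g, x) \<in> carrier \<Gamma>" "linear \<psi>" "\<And>z. z \<in> span M \<Longrightarrow> \<psi> (act g z) = \<psi> z" "\<psi> x \<noteq> 0" "k > 0"
  shows "(g, x) [^]\<^bsub>\<Gamma>\<^esub> (k::nat) \<noteq> \<one>\<^bsub>\<Gamma>\<^esub>"
  using pow_\<Gamma>[OF assms(1), of k, where ?'w=real] assms(2-) by (auto simp: one_\<Gamma> linear_0)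

lemma pow_order_translation:
  assumes "p \<in> carrier \<Gamma>"
  shows "\<exists>y\<in>M. p [^]\<^bsub>\<Gamma>\<^esub> order G = (\<one>, y)"
proof -
  obtain g x where p: "p = (g, x)" by fastforce
  have "g [^] order G = \<one>" using assms unfolding p carrier_\<Gamma> by (simp add: pow_order_eq_1)
  then show ?thesis using pow_\<Gamma>[of g x "order G"] assms T_one unfolding p by auto
qed

lemma pow_of_translation:
  assumes "x \<in> M"
  shows "(\<one>, x) [^]\<^bsub>\<Gamma>\<^esub> k = (\<one>, of_nat k *\<^sub>R x)"
proof -
  have "\<forall>z\<in>span M. id (act \<one> z) = id z" by (simp add: act_one)
  then show ?thesis
    using pow_\<Gamma>[OF translation_in_\<Gamma>[OF assms], of k, where ?'w='v] linear_id by auto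
qed

lemma act_scaled: "g \<in> carrier G \<Longrightarrow> x \<in> M \<Longrightarrow> act g (r *\<^sub>R x) = r *\<^sub>R act g x"
  by (simp add: act_scaleR span_base)

text \<open>
  Powers with exponent \<open>order G\<close> are translations, so translations commute with them.  Conversely,
  they include a multiple of every translation in \<open>M\<close>, and faithfulness of the action shows that only
  translations commute with all these.  The right-hand side speaks of the abstract group only,
  hence isomorphisms map translations to translations.
\<close>
lemma translations_eq_centralizer:
  assumes "p \<in> carrier \<Gamma>"
  shows "fst p = \<one> \<longleftrightarrow>
    (\<forall>q\<in>carrier \<Gamma>. p \<otimes>\<^bsub>\<Gamma>\<^esub> (q [^]\<^bsub>\<Gamma>\<^esub> order G) = (q [^]\<^bsub>\<Gamma>\<^esub> order G) \<otimes>\<^bsub>\<Gamma>\<^esub> p)"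
    (is "_ \<longleftrightarrow> ?C")
proof -
  obtain g x where p: "p = (g, x)" by fastforce
  have g: "g \<in> carrier G" "x \<in> T g" using assms unfolding p carrier_\<Gamma> by auto
  have x: "x \<in> span M" using g T_span by blast
  have "?C" if "g = \<one>"
  proof
    fix q assume "q \<in> carrier \<Gamma>"
    then obtain y where y: "y \<in> M" "q [^]\<^bsub>\<Gamma>\<^esub> order G = (\<one>, y)" using pow_order_translation by blast
    show "p \<otimes>\<^bsub>\<Gamma>\<^esub> (q [^]\<^bsub>\<Gamma>\<^esub> order G) = (q [^]\<^bsub>\<Gamma>\<^esub> order G) \<otimes>\<^bsub>\<Gamma>\<^esub> p"
      using y x that unfolding p y(2) by (simp add: mult_\<Gamma> act_one span_base)
  qed
  moreover have "g = \<one>" if C: "?C"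
  proof (rule faithful[OF g(1)])
    fix m assume m: "m \<in> M"
    have "p \<otimes>\<^bsub>\<Gamma>\<^esub> ((\<one>, m) [^]\<^bsub>\<Gamma>\<^esub> order G) = ((\<one>, m) [^]\<^bsub>\<Gamma>\<^esub> order G) \<otimes>\<^bsub>\<Gamma>\<^esub> p"
      using C translation_in_\<Gamma>[OF m] by blast
    then have "of_nat (order G) *\<^sub>R act g m = of_nat (order G) *\<^sub>R m"
      using x m g unfolding p pow_of_translation[OF m] by (simp add: mult_\<Gamma> act_one act_scaled)
    then show "act g m = m" using order_gt_0_iff_finite finite_group by simp
  qed
  ultimately show ?thesis unfolding p by auto
qed

end

text \<open>
  The isomorphism restricts to an additive bijection \<open>\<theta>\<close> of the translation lattices.
\<close>
lemma iso_imp_rank_le: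
  fixes G :: "('g, 'a) monoid_scheme" and H :: "('h, 'b) monoid_scheme"
    and B :: "'v::real_vector set" and C :: "'w::real_vector set"
  assumes B: "finite B" "independent B" and C: "finite C" "independent C"
    and \<Gamma>: "crystallographic G (int_span B) act T" and \<Delta>: "crystallographic H (int_span C) act' T'"
    and order: "order G = order H"
    and iso: "Crys G act T \<cong> Crys H act' T'"
  shows "card C \<le> card B"
proof -
  interpret \<Gamma>: crystallographic G "int_span B" act T by fact
  interpret \<Delta>: crystallographic H "int_span C" act' T' by fact
  interpret g\<Gamma>: group \<Gamma>.\<Gamma> by (rule \<Gamma>.group_\<Gamma>)
  interpret g\<Delta>: group \<Delta>.\<Gamma> by (rule \<Delta>.group_\<Gamma>)
  obtain f where f: "f \<in> iso \<Gamma>.\<Gamma> \<Delta>.\<Gamma>" using iso unfolding is_iso_def by blast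
  interpret f: group_hom \<Gamma>.\<Gamma> \<Delta>.\<Gamma> f
    using f g\<Gamma>.is_group g\<Delta>.is_group by (simp add: group_hom_def group_hom_axioms_def iso_def)
  have bij: "bij_betw f (carrier \<Gamma>.\<Gamma>) (carrier \<Delta>.\<Gamma>)" using f by (simp add: iso_def)
  have inj: "f p = f q \<longleftrightarrow> p = q" if "p \<in> carrier \<Gamma>.\<Gamma>" "q \<in> carrier \<Gamma>.\<Gamma>" for p q
    using bij that by (auto simp: bij_betw_def inj_on_eq_iff)
  have transl: "fst (f p) = \<one>\<^bsub>H\<^esub> \<longleftrightarrow> fst p = \<one>\<^bsub>G\<^esub>" if p: "p \<in> carrier \<Gamma>.\<Gamma>" for p
  proof -
    have "(\<forall>q\<in>carrier \<Delta>.\<Gamma>. f p \<otimes>\<^bsub>\<Delta>.\<Gamma>\<^esub> (q [^]\<^bsub>\<Delta>.\<Gamma>\<^esub> order H) = (q [^]\<^bsub>\<Delta>.\<Gamma>\<^esub> order H) \<otimes>\<^bsub>\<Delta>.\<Gamma>\<^esub> f p)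
      \<longleftrightarrow> (\<forall>q\<in>carrier \<Gamma>.\<Gamma>. f p \<otimes>\<^bsub>\<Delta>.\<Gamma>\<^esub> (f q [^]\<^bsub>\<Delta>.\<Gamma>\<^esub> order H) = (f q [^]\<^bsub>\<Delta>.\<Gamma>\<^esub> order H) \<otimes>\<^bsub>\<Delta>.\<Gamma>\<^esub> f p)"
      unfolding bij_betw_imp_surj_on[OF bij, symmetric] by (simp only: ball_simps)
    also have "\<dots> \<longleftrightarrow> (\<forall>q\<in>carrier \<Gamma>.\<Gamma>. p \<otimes>\<^bsub>\<Gamma>.\<Gamma>\<^esub> (q [^]\<^bsub>\<Gamma>.\<Gamma>\<^esub> order G) = (q [^]\<^bsub>\<Gamma>.\<Gamma>\<^esub> order G) \<otimes>\<^bsub>\<Gamma>.\<Gamma>\<^esub> p)"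
      using p by (simp add: order[symmetric] f.hom_nat_pow[symmetric] f.hom_mult[symmetric] inj del: f.hom_mult f.hom_nat_pow)
    finally show ?thesis
      using \<Gamma>.translations_eq_centralizer[OF p] \<Delta>.translations_eq_centralizer[OF f.hom_closed[OF p]] by simp
  qed
  define \<theta> where "\<theta> x = snd (f (\<one>\<^bsub>G\<^esub>, x))" for x
  have \<theta>: "f (\<one>\<^bsub>G\<^esub>, x) = (\<one>\<^bsub>H\<^esub>, \<theta> x) \<and> \<theta> x \<in> int_span C" if "x \<in> int_span B" for x
  proof -
    have 1: "f (\<one>\<^bsub>G\<^esub>, x) = (\<one>\<^bsub>H\<^esub>, \<theta> x)"
      using transl[OF \<Gamma>.translation_in_\<Gamma>[OF that]] by (simp add: \<theta>_def prod_eq_iff)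
    moreover have "(\<one>\<^bsub>H\<^esub>, \<theta> x) \<in> carrier \<Delta>.\<Gamma>"
      using f.hom_closed[OF \<Gamma>.translation_in_\<Gamma>[OF that]] unfolding 1 .
    ultimately show ?thesis by (simp add: \<Delta>.carrier_\<Gamma> \<Delta>.T_one)
  qed
  show ?thesis
  proof (rule rank_le_of_additive_surjection[OF B C])
    fix x y assume xy: "x \<in> int_span B" "y \<in> int_span B"
    have "f ((\<one>\<^bsub>G\<^esub>, y) \<otimes>\<^bsub>\<Gamma>.\<Gamma>\<^esub> (\<one>\<^bsub>G\<^esub>, x)) = f (\<one>\<^bsub>G\<^esub>, y) \<otimes>\<^bsub>\<Delta>.\<Gamma>\<^esub> f (\<one>\<^bsub>G\<^esub>, x)"
      using xy \<Gamma>.translation_in_\<Gamma> by simp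
    then show "\<theta> (x + y) = \<theta> x + \<theta> y"
      using xy \<theta> \<Gamma>.add_M[OF xy]
      by (simp add: \<Gamma>.mult_\<Gamma> \<Delta>.mult_\<Gamma> \<Gamma>.act_one \<Delta>.act_one span_base)
  next
    show "int_span C \<subseteq> \<theta> ` int_span B"
    proof
      fix y assume y: "y \<in> int_span C"
      then have "(\<one>\<^bsub>H\<^esub>, y) \<in> carrier \<Delta>.\<Gamma>" by (rule \<Delta>.translation_in_\<Gamma>)
      then obtain g x where p: "(g, x) \<in> carrier \<Gamma>.\<Gamma>" "f (g, x) = (\<one>\<^bsub>H\<^esub>, y)"
        using bij unfolding bij_betw_def by (metis (no_types, lifting) imageE surj_pair)
      then have "g = \<one>\<^bsub>G\<^esub>" using transl[OF p(1)] by simp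
      then have "x \<in> int_span B" "\<theta> x = y" using p by (auto simp: \<theta>_def \<Gamma>.carrier_\<Gamma> \<Gamma>.T_one)
      then show "y \<in> \<theta> ` int_span B" by blast
    qed
  qed
qed

section \<open>The alternating group as a group of affine maps\<close>
text \<open>
  The four points permuted by the group are seen as the plane over the field with two elements,
  with points numbered from 0 to 3.  Addition of points is the Klein four-group law: two distinct
  nonzero points add up to the third one, and the numbers 1, 2, 3 have the sum 6.
\<close>
definition vadd :: "nat \<Rightarrow> nat \<Rightarrow> nat" where
  "vadd v w = (if v = 0 then w else if w = 0 then v else if v = w then 0 else 6 - v - w)"

text \<open>
  The \<open>i\<close>-th power of the linear map of order 3 that permutes the points 1, 2, 3 cyclically.
\<close>
definition rot :: "nat \<Rightarrow> nat \<Rightarrow> nat" where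
  "rot i w = (if w = 0 then 0 else (w - 1 + i) mod 3 + 1)"

text \<open>
  The affine map \<open>x \<mapsto> v + rot i x\<close> as a permutation of \<open>{1..4}\<close>, where 4 stands for the origin of the plane.
\<close>
definition affine_perm :: "nat \<Rightarrow> nat \<Rightarrow> nat \<Rightarrow> nat" where
  "affine_perm v i x = (if x \<in> {1..4} then
     (let y = vadd v (rot i (x mod 4)) in if y = 0 then 4 else y) else x)"

lemma less_4_cases: "(v::nat) < 4 \<Longrightarrow> v = 0 \<or> v = 1 \<or> v = 2 \<or> v = 3"
  and less_3_cases: "(i::nat) < 3 \<Longrightarrow> i = 0 \<or> i = 1 \<or> i = 2"
  by auto

lemma vadd_less_4: "v < 4 \<Longrightarrow> w < 4 \<Longrightarrow> vadd v w < 4"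
  by (auto simp: vadd_def)

lemma rot_less_4: "rot i w < 4"
  by (simp add: rot_def)

lemma vadd_table:
  "vadd 0 v = v" "vadd v 0 = v" "vadd v v = 0"
  "vadd 1 2 = 3" "vadd 2 1 = 3" "vadd 1 3 = 2" "vadd 3 1 = 2" "vadd 2 3 = 1" "vadd 3 2 = 1"
  by (simp_all add: vadd_def)

lemma rot_table:
  "rot i 0 = 0"
  "rot 0 1 = 1" "rot 0 2 = 2" "rot 0 3 = 3"
  "rot 1 1 = 2" "rot 1 2 = 3" "rot 1 3 = 1"
  "rot 2 1 = 3" "rot 2 2 = 1" "rot 2 3 = 2"
  by (simp_all add: rot_def)

lemma vadd_assoc:
  assumes "u < 4" "v < 4" "w < 4"
  shows "vadd (vadd u v) w = vadd u (vadd v w)"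
  using assms[THEN less_4_cases] by (elim disjE; simp only: vadd_table)

lemma rot_mod: "rot (i mod 3) w = rot i w"
  by (cases w) (simp_all add: rot_def mod_add_right_eq)

lemma rot_vadd:
  assumes "v < 4" "w < 4"
  shows "rot i (vadd v w) = vadd (rot i v) (rot i w)"
proof -
  have "rot k (vadd v w) = vadd (rot k v) (rot k w)" if "k < 3" for k
    using less_3_cases[OF that] assms[THEN less_4_cases]
    by (elim disjE; simp only: vadd_table rot_table)
  from this[of "i mod 3"] show ?thesis by (simp add: rot_mod)
qed

lemma rot_rot: "rot i (rot k w) = rot ((i + k) mod 3) w"
proof (cases "w = 0")
  case False
  have "((w - 1 + k) mod 3 + i) mod 3 = (w - 1 + (i + k) mod 3) mod 3"
    by (metis add.assoc add.commute mod_add_left_eq)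
  then show ?thesis using False by (simp add: rot_def)
qed (simp add: rot_def)

lemma affine_perm_outside: "x \<notin> {1..4} \<Longrightarrow> affine_perm v i x = x"
  by (auto simp: affine_perm_def)

lemma affine_perm_comp:
  assumes "v < 4" "w < 4" "i < 3" "k < 3"
  shows "affine_perm v i \<circ> affine_perm w k = affine_perm (vadd v (rot i w)) ((i + k) mod 3)"
proof
  fix x
  show "(affine_perm v i \<circ> affine_perm w k) x = affine_perm (vadd v (rot i w)) ((i + k) mod 3) x"
  proof (cases "x \<in> {1..4}")
    case True
    define y where "y = vadd w (rot k (x mod 4))"
    have y: "y < 4" unfolding y_def by (intro vadd_less_4 assms rot_less_4)
    have "affine_perm w k x = (if y = 0 then 4 else y)"
      using True by (simp add: affine_perm_def y_def Let_def)
    then have "affine_perm w k x \<in> {1..4}" "affine_perm w k x mod 4 = y" using y by auto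
    moreover have "vadd v (rot i y) = vadd (vadd v (rot i w)) (rot ((i + k) mod 3) (x mod 4))"
      unfolding y_def using assms by (simp add: rot_vadd rot_less_4 rot_rot vadd_assoc)
    ultimately show ?thesis using True by (simp add: affine_perm_def Let_def)
  next
    case False
    then show ?thesis by (simp only: comp_apply affine_perm_outside[OF False])
  qed
qed

lemma affine_perm_id: "affine_perm 0 0 = id"
proof
  fix x :: nat
  have "x \<in> {1..4} \<Longrightarrow> x = 1 \<or> x = 2 \<or> x = 3 \<or> x = 4" by auto
  then show "affine_perm 0 0 x = id x"
    by (cases "x \<in> {1..4}") (auto simp: affine_perm_def vadd_def rot_def)
qed

lemma affine_perm_inverse:
  assumes "v < 4" "i < 3"
  shows "\<exists>w<4. \<exists>k<3. affine_perm v i \<circ> affine_perm w k = id \<and> affine_perm w k \<circ> affine_perm v i = id"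
proof (intro exI conjI)
  define k where "k = (3 - i) mod 3"
  show k: "k < 3" by (simp add: k_def)
  show w: "rot k v < 4" by (rule rot_less_4)
  have ik: "(i + k) mod 3 = 0" "(k + i) mod 3 = 0" "rot 0 v = v" "vadd v v = 0" "vadd (rot k v) (rot k v) = 0"
    using less_3_cases[OF assms(2)] less_4_cases[OF assms(1)] by (auto simp: k_def rot_def vadd_def)
  show "affine_perm v i \<circ> affine_perm (rot k v) k = id"
    using affine_perm_comp[OF assms(1) w assms(2) k] ik by (simp add: rot_rot affine_perm_id)
  show "affine_perm (rot k v) k \<circ> affine_perm v i = id"
    using affine_perm_comp[OF w assms(1) k assms(2)] ik by (simp add: affine_perm_id)
qed

lemma affine_perm_permutes:
  assumes "v < 4" "i < 3"
  shows "affine_perm v i permutes {1..4}"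
proof (rule bij_imp_permutes)
  have maps: "affine_perm w k x \<in> {1..4}" if "x \<in> {1..4}" "w < 4" for w k x
    using that vadd_less_4[OF that(2) rot_less_4[of k "x mod 4"]] by (auto simp: affine_perm_def Let_def)
  obtain w k where w: "w < 4" "affine_perm v i \<circ> affine_perm w k = id" "affine_perm w k \<circ> affine_perm v i = id"
    using affine_perm_inverse[OF assms] by blast
  show "bij_betw (affine_perm v i) {1..4} {1..4}"
    by (rule bij_betw_byWitness[where f' = "affine_perm w k"])
      (use maps assms w in \<open>auto simp: fun_eq_iff\<close>)
qed (rule affine_perm_outside)

text \<open>
  A nontrivial rotational part makes the map an element of order 3, which is the square of its
  inverse and hence even.  A translation is a product of two such maps.
\<close>
lemma affine_perm_even:
  assumes "v < 4" "i < 3"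
  shows "evenperm (affine_perm v i)"
proof -
  have perm: "permutation (affine_perm w k)" if "w < 4" "k < 3" for w k
    using affine_perm_permutes[OF that] permutation_permutes by blast
  have sq: "evenperm (affine_perm w k \<circ> affine_perm w k)" if "w < 4" "k < 3" for w k
    using evenperm_comp[OF perm perm] that by blast
  have rotating: "evenperm (affine_perm w k)" if "w < 4" "k = 1 \<or> k = 2" for w k
  proof -
    define u l where "u = vadd w (rot k w)" and "l = 3 - k"
    have l: "l < 3" "(l + l) mod 3 = k" using that(2) by (auto simp: l_def)
    have u: "vadd u (rot l u) = w"
      using less_4_cases[OF that(1)] that(2) unfolding u_def l_def
      by (elim disjE; hypsubst; simp add: vadd_table rot_table flip: One_nat_def)
    have "u < 4" unfolding u_def using that(1) by (intro vadd_less_4 rot_less_4)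
    then show ?thesis
      using sq[of u l] affine_perm_comp[of u u l l] l u by simp
  qed
  show ?thesis
  proof (cases "i = 0")
    case True
    have "affine_perm v i = affine_perm v 1 \<circ> affine_perm 0 2"
      using True affine_perm_comp[of v 0 1 2] assms by (simp add: vadd_table rot_table)
    then show ?thesis
      using evenperm_comp[OF perm[OF assms(1), of 1] perm[of 0 2]] rotating[of v 1] rotating[of 0 2] assms by simp
  next
    case False
    then show ?thesis using rotating assms by (metis less_3_cases)
  qed
qed

text \<open>
  There are twelve affine maps of this kind, as many as there are even permutations.
\<close>
lemma affine_perm_bij:
  "bij_betw (\<lambda>(v, i). affine_perm v i) ({..<4} \<times> {..<3}) (carrier (alt_group 4))"
proof -
  have inj: "inj_on (\<lambda>(v, i). affine_perm v i) ({..<4} \<times> {..<3})"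
  proof (rule inj_onI, clarify)
    fix v i w k :: nat
    assume *: "v < 4" "i < 3" "w < 4" "k < 3" and eq: "affine_perm v i = affine_perm w k"
    have at: "affine_perm u l 4 = (if u = 0 then 4 else u)" for u l
      by (simp add: affine_perm_def rot_def vadd_def)
    have vw: "v = w" using fun_cong[OF eq, of 4] * unfolding at by (auto split: if_splits)
    define y z where "y = vadd v (rot i 1)" and "z = vadd v (rot k 1)"
    have yz: "y < 4" "z < 4" unfolding y_def z_def using * by (auto intro: vadd_less_4 rot_less_4)
    have at1: "affine_perm v l 1 = (if vadd v (rot l 1) = 0 then 4 else vadd v (rot l 1))" for l
      by (simp add: affine_perm_def Let_def)
    have "(if y = 0 then 4 else y) = (if z = 0 then 4 else z)"
      using eq at1[of i] at1[of k] unfolding vw y_def z_def by metis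
    then have "y = z" using yz by (auto split: if_splits)
    then have "vadd (vadd v v) (rot i 1) = vadd (vadd v v) (rot k 1)"
      using vadd_assoc[OF *(1) *(1) rot_less_4] by (simp add: y_def z_def)
    then have "i = k" using * by (simp add: vadd_table rot_def)
    with vw show "v = w \<and> i = k" by simp
  qed
  have sub: "(\<lambda>(v, i). affine_perm v i) ` ({..<4} \<times> {..<3}) \<subseteq> carrier (alt_group 4)"
    using affine_perm_permutes affine_perm_even by (auto simp: alt_group_carrier)
  have "2 * card (carrier (alt_group 4)) = fact 4"
    by (rule alt_group_card_carrier) simp
  moreover have "fact 4 = (24::nat)" by (simp add: fact_numeral)
  ultimately have card: "card (carrier (alt_group 4)) = 12" by simp
  have "(\<lambda>(v, i). affine_perm v i) ` ({..<4} \<times> {..<3}) = carrier (alt_group 4)"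
  proof (rule card_subset_eq[OF _ sub])
    show "finite (carrier (alt_group 4))" using card card_ge_0_finite by force
    show "card ((\<lambda>(v, i). affine_perm v i) ` ({..<4} \<times> {..<3})) = card (carrier (alt_group 4))"
      using card card_image[OF inj] by simp
  qed
  with inj show ?thesis by (simp add: bij_betw_def)
qed

section \<open>Coordinates\<close>
type_synonym vector = "nat \<Rightarrow>\<^sub>0 real"

text \<open>
  The coordinates of a vector come in groups of six, one group for each \<open>l\<close>: first the coordinates of
  \<open>e\<^sub>l\<close> in the copies \<open>j = 0, 1, 2\<close>, and then those of \<open>f\<^sub>l\<close> in these copies.  The lattice for \<open>n\<close> uses the first
  \<open>6 * n\<close> coordinates.
\<close>
definition ecoord :: "vector \<Rightarrow> nat \<Rightarrow> nat \<Rightarrow> real" where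
  "ecoord x j l = Poly_Mapping.lookup x (6 * l + j)"

definition fcoord :: "vector \<Rightarrow> nat \<Rightarrow> nat \<Rightarrow> real" where
  "fcoord x j l = Poly_Mapping.lookup x (6 * l + 3 + j)"

definition vec_of :: "nat \<Rightarrow> (nat \<Rightarrow> nat \<Rightarrow> real) \<Rightarrow> (nat \<Rightarrow> nat \<Rightarrow> real) \<Rightarrow> vector" where
  "vec_of n E F = Abs_poly_mapping (\<lambda>k. if k < 6 * n
     then if k mod 6 < 3 then E (k mod 6) (k div 6) else F (k mod 6 - 3) (k div 6) else 0)"

definition coord_space :: "nat \<Rightarrow> vector set" where
  "coord_space n = {x. \<forall>k\<ge>6 * n. Poly_Mapping.lookup x k = 0}"

definition int_vectors :: "nat \<Rightarrow> vector set" where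
  "int_vectors n = {x \<in> coord_space n. \<forall>k. Poly_Mapping.lookup x k \<in> \<int>}"

lemma lookup_vec_of:
  "Poly_Mapping.lookup (vec_of n E F) k = (if k < 6 * n
     then if k mod 6 < 3 then E (k mod 6) (k div 6) else F (k mod 6 - 3) (k div 6) else 0)"
  unfolding vec_of_def by (subst lookup_Abs_poly_mapping) (auto intro: finite_subset[of _ "{..<6 * n}"])

lemma ecoord_vec_of: "j < 3 \<Longrightarrow> ecoord (vec_of n E F) j l = (if l < n then E j l else 0)"
  and fcoord_vec_of: "j < 3 \<Longrightarrow> fcoord (vec_of n E F) j l = (if l < n then F j l else 0)"
proof -
  assume j: "j < 3"
  have "(6 * l + j) mod 6 = j" "(6 * l + j) div 6 = l" "6 * l + j < 6 * n \<longleftrightarrow> l < n" using j by auto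
  then show "ecoord (vec_of n E F) j l = (if l < n then E j l else 0)"
    unfolding ecoord_def lookup_vec_of using j by simp
  have "(6 * l + 3 + j) mod 6 = j + 3" "(6 * l + 3 + j) div 6 = l" "6 * l + 3 + j < 6 * n \<longleftrightarrow> l < n"
    using j mod_mult_self2[of "j + 3" 6 l] div_mult_self2[of 6 "j + 3" l] by (auto simp: ac_simps)
  then show "fcoord (vec_of n E F) j l = (if l < n then F j l else 0)"
    unfolding fcoord_def lookup_vec_of by simp
qed

lemma index_cases:
  obtains j l where "j < 3" "k = 6 * l + j" | j l where "j < 3" "k = 6 * l + 3 + (j::nat)"
proof (cases "k mod 6 < 3")
  case True
  then show ?thesis using that(1)[of "k mod 6" "k div 6"] by simp
next
  case False
  then have "k mod 6 - 3 < 3" "k = 6 * (k div 6) + 3 + (k mod 6 - 3)"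
    by (simp_all add: less_diff_conv2)
  then show ?thesis by (rule that(2))
qed

lemma all_lookup_iff:
  "(\<forall>k. P k (Poly_Mapping.lookup x k)) \<longleftrightarrow>
     (\<forall>j<3. \<forall>l. P (6 * l + j) (ecoord x j l) \<and> P (6 * l + 3 + j) (fcoord x j l))"
  unfolding ecoord_def fcoord_def by (metis index_cases)

lemma vector_eqI:
  assumes "\<And>j l. j < 3 \<Longrightarrow> ecoord x j l = ecoord y j l"
    and "\<And>j l. j < 3 \<Longrightarrow> fcoord x j l = fcoord y j l"
  shows "x = y"
proof (rule poly_mapping_eqI)
  have "\<forall>k. Poly_Mapping.lookup x k = Poly_Mapping.lookup y k"
    using all_lookup_iff[of "\<lambda>k r. r = Poly_Mapping.lookup y k" x] assms
    by (simp add: ecoord_def fcoord_def)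
  then show "Poly_Mapping.lookup x k = Poly_Mapping.lookup y k" for k by blast
qed

lemma coord_space_iff:
  "x \<in> coord_space n \<longleftrightarrow> (\<forall>j<3. \<forall>l\<ge>n. ecoord x j l = 0 \<and> fcoord x j l = 0)"
proof -
  have "6 * n \<le> 6 * l + j \<longleftrightarrow> n \<le> l" "6 * n \<le> 6 * l + 3 + j \<longleftrightarrow> n \<le> l" if "j < 3" for j l :: nat
    using that by auto
  then show ?thesis
    unfolding coord_space_def
    using all_lookup_iff[of "\<lambda>k r. 6 * n \<le> k \<longrightarrow> r = 0" x] by auto
qed

lemma int_vectors_iff:
  "x \<in> int_vectors n \<longleftrightarrow> x \<in> coord_space n \<and> (\<forall>j<3. \<forall>l. ecoord x j l \<in> \<int> \<and> fcoord x j l \<in> \<int>)"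
  unfolding int_vectors_def using all_lookup_iff[of "\<lambda>k r. r \<in> \<int>" x] by simp

lemma lookup_scaleR: "Poly_Mapping.lookup (r *\<^sub>R x) k = r * Poly_Mapping.lookup (x :: vector) k"
proof -
  have "finite {k. Poly_Mapping.lookup x k \<noteq> 0}" by simp
  then have "finite {k. r *\<^sub>R Poly_Mapping.lookup x k \<noteq> 0}" by (rule rev_finite_subset) auto
  then show ?thesis by (simp add: scaleR_poly_mapping_def)
qed

lemma coord_simps [simp]:
  "ecoord (x + y) j l = ecoord x j l + ecoord y j l" "fcoord (x + y) j l = fcoord x j l + fcoord y j l"
  "ecoord (x - y) j l = ecoord x j l - ecoord y j l" "fcoord (x - y) j l = fcoord x j l - fcoord y j l"
  "ecoord (r *\<^sub>R x) j l = r * ecoord x j l" "fcoord (r *\<^sub>R x) j l = r * fcoord x j l"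
  "ecoord 0 j l = 0" "fcoord 0 j l = 0"
  by (simp_all add: ecoord_def fcoord_def lookup_add lookup_minus lookup_scaleR)

lemma vec_of_in_coord_space: "vec_of n E F \<in> coord_space n"
  by (simp add: coord_space_iff ecoord_vec_of fcoord_vec_of)

section \<open>The action on three copies of a module of the Klein four-group\<close>
text \<open>
  Number 0 is the neutral element of the Klein four-group, and 1, 2, 3 are the involutions \<open>a, b, c\<close> of the
  copy 0.  In copy \<open>j\<close> the involution \<open>v\<close> acts by the formulas for \<open>role v j\<close>; in particular \<open>j + 1\<close> plays the
  role of \<open>a\<close> there.
\<close>
definition role :: "nat \<Rightarrow> nat \<Rightarrow> nat" where
  "role v j = rot (3 - j) v"

text \<open>
  The copy \<open>j - i\<close> modulo 3, which the rotation with exponent \<open>i\<close> moves to copy \<open>j\<close>.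
\<close>
definition source :: "nat \<Rightarrow> nat \<Rightarrow> nat" where
  "source i j = (j + 2 * i) mod 3"

text \<open>
  Coordinates of the image of a vector under the group element in role \<open>r\<close>, where \<open>A\<close> and \<open>B\<close> are the
  \<open>e\<close>- and \<open>f\<close>-coordinates of the vector within one copy.  On basis vectors this means
  \<open>a e\<^sub>l = (-1)\<^sup>l e\<^sub>l + f\<^sub>l\<close> and \<open>a f\<^sub>l = - (-1)\<^sup>l f\<^sub>l\<close>, further \<open>b e\<^sub>l = (-1)\<^sup>l (e\<^sub>l - f\<^bsub>l-1\<^esub>)\<close> and \<open>b f\<^sub>l = (-1)\<^sup>l f\<^sub>l\<close>,
  and \<open>c = a b\<close>.  The alternating signs are what makes \<open>a\<close> and \<open>b\<close> commuting involutions over the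
  integers.
\<close>
definition local_e :: "nat \<Rightarrow> (nat \<Rightarrow> real) \<Rightarrow> nat \<Rightarrow> real" where
  "local_e r A l = (if r = 1 \<or> r = 2 then (-1) ^ l * A l else A l)"

definition local_f :: "nat \<Rightarrow> (nat \<Rightarrow> real) \<Rightarrow> (nat \<Rightarrow> real) \<Rightarrow> nat \<Rightarrow> real" where
  "local_f r A B l =
     (if r = 0 then B l
      else if r = 1 then A l - (-1) ^ l * B l
      else if r = 2 then (-1) ^ l * (B l + A (Suc l))
      else (-1) ^ l * A l - B l - A (Suc l))"

definition move :: "nat \<Rightarrow> nat \<Rightarrow> nat \<Rightarrow> vector \<Rightarrow> vector" where
  "move n v i x = vec_of n
     (\<lambda>j. local_e (role v j) (ecoord x (source i j)))
     (\<lambda>j. local_f (role v j) (ecoord x (source i j)) (fcoord x (source i j)))"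

lemma local_comp:
  assumes "r < 4" "s < 4"
  shows "local_e r (local_e s A) = local_e (vadd r s) A"
    and "local_f r (local_e s A) (local_f s A B) = local_f (vadd r s) A B"
proof -
  have sgn: "(-1 :: real) ^ l * ((-1) ^ l * a) = a" for l a
    by (simp flip: mult.assoc power_add)
  show "local_e r (local_e s A) = local_e (vadd r s) A"
    using assms[THEN less_4_cases]
    by (elim disjE; hypsubst; simp only: vadd_table; simp add: local_e_def sgn fun_eq_iff)
  show "local_f r (local_e s A) (local_f s A B) = local_f (vadd r s) A B"
    using assms[THEN less_4_cases]
    by (elim disjE; hypsubst; simp only: vadd_table;
        simp add: local_e_def local_f_def sgn fun_eq_iff algebra_simps)
qed

lemma role_less_4: "role v j < 4"
  by (simp add: role_def rot_less_4)

lemma role_0: "role 0 j = 0"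
  by (simp add: role_def rot_table)

lemma role_vadd: "v < 4 \<Longrightarrow> w < 4 \<Longrightarrow> role (vadd v w) j = vadd (role v j) (role w j)"
  by (simp add: role_def rot_vadd)

lemma source_less_3: "source i j < 3"
  by (simp add: source_def)

lemma source_0: "j < 3 \<Longrightarrow> source 0 j = j"
  by (simp add: source_def)

lemma source_source: "source k (source i j) = source ((i + k) mod 3) j"
proof -
  have "(j + 2 * i + 2 * k) mod 3 = (j + 2 * (i + k) mod 3) mod 3"
    by (metis add.assoc distrib_left mod_add_right_eq)
  also have "\<dots> = (j + 2 * ((i + k) mod 3)) mod 3"
    by (metis mod_add_right_eq mod_mult_right_eq)
  finally show ?thesis
    unfolding source_def by (simp add: mod_add_left_eq)
qed

text \<open>
  Conjugation by the rotation permutes the involutions in the same way as it permutes the copies;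
  together with \<open>role_vadd\<close> this makes \<open>move\<close> an action of the affine group.
\<close>
lemma role_rot:
  assumes "i < 3" "j < 3"
  shows "role (rot i w) j = role w (source i j)"
proof -
  have "(3 - j + i) mod 3 = (3 - source i j) mod 3"
    using assms[THEN less_3_cases] by (elim disjE; simp add: source_def)
  then show ?thesis by (simp add: role_def rot_rot) (metis rot_mod)
qed

lemma move_coord:
  assumes "x \<in> coord_space n" "j < 3"
  shows "ecoord (move n v i x) j l = local_e (role v j) (ecoord x (source i j)) l"
    and "fcoord (move n v i x) j l = local_f (role v j) (ecoord x (source i j)) (fcoord x (source i j)) l"
proof -
  have "ecoord x (source i j) l' = 0 \<and> fcoord x (source i j) l' = 0" if "l' \<ge> n" for l'
    using assms(1) source_less_3 that by (simp add: coord_space_iff)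
  then show "ecoord (move n v i x) j l = local_e (role v j) (ecoord x (source i j)) l"
    "fcoord (move n v i x) j l = local_f (role v j) (ecoord x (source i j)) (fcoord x (source i j)) l"
    using assms(2) by (auto simp: move_def ecoord_vec_of fcoord_vec_of local_e_def local_f_def)
qed

lemma move_in_coord_space: "move n v i x \<in> coord_space n"
  by (simp add: move_def vec_of_in_coord_space)

lemma move_move:
  assumes "x \<in> coord_space n" "v < 4" "w < 4" "i < 3"
  shows "move n v i (move n w k x) = move n (vadd v (rot i w)) ((i + k) mod 3) x"
proof -
  note m = move_coord[OF assms(1)] move_coord[OF move_in_coord_space]
  have role: "role (vadd v (rot i w)) j = vadd (role v j) (role w (source i j))" if "j < 3" for j
    using assms that by (simp add: role_vadd rot_less_4 role_rot)
  have e: "ecoord (move n w k x) (source i j) = local_e (role w (source i j)) (ecoord x (source ((i + k) mod 3) j))" for j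
    using m(1)[OF source_less_3] by (simp add: fun_eq_iff source_source)
  have f: "fcoord (move n w k x) (source i j) = local_f (role w (source i j))
      (ecoord x (source ((i + k) mod 3) j)) (fcoord x (source ((i + k) mod 3) j))" for j
    using m(2)[OF source_less_3] by (simp add: fun_eq_iff source_source)
  show ?thesis
    by (rule vector_eqI) (simp_all add: m e f role local_comp role_less_4)
qed

lemma move_0_0: "x \<in> coord_space n \<Longrightarrow> move n 0 0 x = x"
  by (rule vector_eqI) (simp_all add: move_coord role_0 source_0 local_e_def local_f_def)

lemma move_add: "move n v i (x + y) = move n v i x + move n v i y"
  by (rule vector_eqI) (auto simp: move_def ecoord_vec_of fcoord_vec_of local_e_def local_f_def algebra_simps)

lemma move_scaleR: "move n v i (r *\<^sub>R x) = r *\<^sub>R move n v i x"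
  by (rule vector_eqI) (auto simp: move_def ecoord_vec_of fcoord_vec_of local_e_def local_f_def algebra_simps)

section \<open>The lattice\<close>
definition weight :: "vector \<Rightarrow> real" where
  "weight x = ecoord x 0 0 + ecoord x 1 0 + ecoord x 2 0"

text \<open>
  The restriction on the weight makes the weight of a cocycle modulo 3 meaningful; it is what detects
  elements of order 3.
\<close>
definition crys_lattice :: "nat \<Rightarrow> vector set" where
  "crys_lattice n = {x \<in> int_vectors n. weight x / 3 \<in> \<int>}"

lemma weight_simps [simp]:
  "weight (x + y) = weight x + weight y" "weight (x - y) = weight x - weight y"
  "weight (r *\<^sub>R x) = r * weight x" "weight 0 = 0"
  by (simp_all add: weight_def algebra_simps)

lemma int_vectors_simps:
  shows int_vectors_0: "0 \<in> int_vectors n"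
    and int_vectors_add: "x \<in> int_vectors n \<Longrightarrow> y \<in> int_vectors n \<Longrightarrow> x + y \<in> int_vectors n"
    and int_vectors_diff: "x \<in> int_vectors n \<Longrightarrow> y \<in> int_vectors n \<Longrightarrow> x - y \<in> int_vectors n"
    and int_vectors_scaleR: "r \<in> \<int> \<Longrightarrow> x \<in> int_vectors n \<Longrightarrow> r *\<^sub>R x \<in> int_vectors n"
  by (auto simp: int_vectors_iff coord_space_iff)

lemma crys_lattice_simps:
  shows crys_lattice_add: "x \<in> crys_lattice n \<Longrightarrow> y \<in> crys_lattice n \<Longrightarrow> x + y \<in> crys_lattice n"
    and crys_lattice_diff: "x \<in> crys_lattice n \<Longrightarrow> y \<in> crys_lattice n \<Longrightarrow> x - y \<in> crys_lattice n"
  by (auto simp: crys_lattice_def add_divide_distrib diff_divide_distrib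
      int_vectors_add int_vectors_diff)

lemma crys_lattice_0: "0 \<in> crys_lattice n"
  by (simp add: crys_lattice_def int_vectors_0)

lemma int_vectors_subset: "int_vectors n \<subseteq> coord_space n"
  by (auto simp: int_vectors_def)

lemma crys_lattice_subset: "crys_lattice n \<subseteq> int_vectors n"
  by (auto simp: crys_lattice_def)

lemma subspace_coord_space: "subspace (coord_space n)"
  by (auto simp: subspace_def coord_space_iff)

lemma weight_move:
  assumes "x \<in> coord_space n" "i < 3"
  shows "weight (move n v i x) = weight x"
proof -
  have "weight (move n v i x) = ecoord x (source i 0) 0 + ecoord x (source i 1) 0 + ecoord x (source i 2) 0"
    using assms(1) by (simp add: weight_def move_coord local_e_def)
  also have "\<dots> = weight x"
    using less_3_cases[OF assms(2)] by (elim disjE) (simp_all add: weight_def source_def numeral_2_eq_2)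
  finally show ?thesis .
qed

lemma move_int_vectors:
  assumes "x \<in> int_vectors n"
  shows "move n v i x \<in> int_vectors n"
proof -
  have x: "x \<in> coord_space n" using assms int_vectors_subset by blast
  have "ecoord x (source i j) l \<in> \<int>" "fcoord x (source i j) l \<in> \<int>" for j l
    using assms source_less_3 by (simp_all add: int_vectors_iff)
  then show ?thesis
    unfolding int_vectors_iff
    by (auto simp: move_in_coord_space move_coord[OF x] local_e_def local_f_def)
qed

lemma move_crys_lattice: "x \<in> crys_lattice n \<Longrightarrow> i < 3 \<Longrightarrow> move n v i x \<in> crys_lattice n"
  using int_vectors_subset by (auto simp: crys_lattice_def weight_move move_int_vectors subset_iff)

text \<open>
  The weight of a vector is the sum of its first three coordinates, so divisibility of this sum by 3
  only changes the first three of the standard basis vectors.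
\<close>
definition basis_vector :: "nat \<Rightarrow> vector" where
  "basis_vector k =
     (if k = 0 then Poly_Mapping.single 0 3
      else if k < 3 then Poly_Mapping.single k 1 - Poly_Mapping.single 0 1
      else Poly_Mapping.single k 1)"

definition lattice_basis :: "nat \<Rightarrow> vector set" where
  "lattice_basis n = basis_vector ` {..<6 * n}"

lemma lookup_basis_vector:
  "Poly_Mapping.lookup (basis_vector k) m =
     (if m = 0 then if k = 0 then 3 else if k < 3 then -1 else 0 else if m = k then 1 else 0)"
  by (auto simp: basis_vector_def lookup_minus lookup_single when_def
      simp del: single_numeral single_one)

lemma inj_basis_vector: "inj basis_vector"
proof (rule injI, rule ccontr)
  fix k m assume eq: "basis_vector k = basis_vector m" and "k \<noteq> m"
  moreover have "False" if "basis_vector k = basis_vector m" "k \<noteq> m" "k \<noteq> 0" for k m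
    using arg_cong[OF that(1), of "\<lambda>x. Poly_Mapping.lookup x k"] that(2,3) by (simp add: lookup_basis_vector)
  ultimately show False by (metis (full_types))
qed

lemma lookup_combination:
  assumes "n > 0"
  shows "Poly_Mapping.lookup (\<Sum>k<6 * n. c k *\<^sub>R basis_vector k) m =
    (if m = 0 then 3 * c 0 - c 1 - c 2 else if m < 6 * n then c m else 0)"
proof -
  have *: "Poly_Mapping.lookup (\<Sum>k<6 * n. c k *\<^sub>R basis_vector k) m =
      (\<Sum>k<6 * n. c k * Poly_Mapping.lookup (basis_vector k) m)"
    by (simp add: lookup_sum lookup_scaleR)
  show ?thesis
  proof (cases "m = 0")
    case True
    have "(\<Sum>k<6 * n. c k * Poly_Mapping.lookup (basis_vector k) 0) =
        (\<Sum>k\<in>{0,1,2}. c k * Poly_Mapping.lookup (basis_vector k) 0)"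
      using assms by (intro sum.mono_neutral_right) (auto simp: lookup_basis_vector)
    then show ?thesis using * True by (simp add: lookup_basis_vector)
  next
    case False
    have "(\<Sum>k<6 * n. c k * Poly_Mapping.lookup (basis_vector k) m) =
        (\<Sum>k<6 * n. if k = m then c m else 0)"
      using False by (intro sum.cong) (auto simp: lookup_basis_vector)
    then show ?thesis using * False by simp
  qed
qed

lemma weight_lookup: "weight x = Poly_Mapping.lookup x 0 + Poly_Mapping.lookup x 1 + Poly_Mapping.lookup x 2"
  by (simp add: weight_def ecoord_def numeral_2_eq_2)

lemma coord_space_expansion:
  assumes "n > 0" "x \<in> coord_space n"
  shows "x = (\<Sum>k<6 * n. (if k = 0 then weight x / 3 else Poly_Mapping.lookup x k) *\<^sub>R basis_vector k)"
  by (rule poly_mapping_eqI)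
    (use assms in \<open>auto simp: lookup_combination weight_lookup coord_space_def add_divide_distrib\<close>)

lemma lattice_basis_sum:
  "(\<Sum>b\<in>lattice_basis n. f b *\<^sub>R b) = (\<Sum>k<6 * n. f (basis_vector k) *\<^sub>R basis_vector k)"
  unfolding lattice_basis_def
  by (subst sum.reindex) (auto intro: inj_on_subset[OF inj_basis_vector])

lemma finite_lattice_basis: "finite (lattice_basis n)"
  by (simp add: lattice_basis_def)

lemma card_lattice_basis: "card (lattice_basis n) = 6 * n"
  unfolding lattice_basis_def by (simp add: card_image inj_on_subset[OF inj_basis_vector])

lemma independent_lattice_basis:
  assumes "n > 0"
  shows "independent (lattice_basis n)"
proof (rule independent_if_scalars_zero[OF finite_lattice_basis])
  fix f b assume "(\<Sum>b\<in>lattice_basis n. f b *\<^sub>R b) = 0" and b: "b \<in> lattice_basis n"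
  then have 0: "(\<Sum>k<6 * n. f (basis_vector k) *\<^sub>R basis_vector k) = 0" by (simp add: lattice_basis_sum)
  have nz: "f (basis_vector m) = 0" if "m < 6 * n" "m \<noteq> 0" for m
    using lookup_combination[OF assms, of "\<lambda>k. f (basis_vector k)" m] that 0 by simp
  moreover have "f (basis_vector 0) = 0"
    using lookup_combination[OF assms, of "\<lambda>k. f (basis_vector k)" 0] 0 nz[of 1] nz[of 2] assms by simp
  ultimately show "f b = 0" using b unfolding lattice_basis_def by (metis imageE lessThan_iff)
qed

lemma crys_lattice_eq_int_span:
  assumes "n > 0"
  shows "crys_lattice n = int_span (lattice_basis n)"
proof
  show "int_span (lattice_basis n) \<subseteq> crys_lattice n"
  proof
    fix x assume "x \<in> int_span (lattice_basis n)"
    then obtain c :: "vector \<Rightarrow> int" where "x = (\<Sum>b\<in>lattice_basis n. of_int (c b) *\<^sub>R b)"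
      by (auto simp: int_span_def)
    then have x: "x = (\<Sum>k<6 * n. of_int (c (basis_vector k)) *\<^sub>R basis_vector k)"
      using lattice_basis_sum[of "\<lambda>b. of_int (c b)" n] by simp
    show "x \<in> crys_lattice n"
      unfolding crys_lattice_def int_vectors_def coord_space_def weight_lookup x
      using assms by (auto simp: lookup_combination)
  qed
  show "crys_lattice n \<subseteq> int_span (lattice_basis n)"
  proof
    fix x assume x: "x \<in> crys_lattice n"
    define c where "c b = (let k = inv' basis_vector b in
      if k = 0 then \<lfloor>weight x / 3\<rfloor> else \<lfloor>Poly_Mapping.lookup x k\<rfloor>)" for b
    have c: "of_int (c (basis_vector k)) = (if k = 0 then weight x / 3 else Poly_Mapping.lookup x k)" for k
      using x by (simp add: c_def crys_lattice_def int_vectors_def inv_f_f[OF inj_basis_vector])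
    have "x \<in> coord_space n" using x crys_lattice_subset int_vectors_subset by blast
    then have "x = (\<Sum>k<6 * n. of_int (c (basis_vector k)) *\<^sub>R basis_vector k)"
      unfolding c by (rule coord_space_expansion[OF assms])
    then show "x \<in> int_span (lattice_basis n)"
      using int_spanI[of c "lattice_basis n"] lattice_basis_sum[of "\<lambda>b. of_int (c b)" n] by simp
  qed
qed

lemma span_crys_lattice:
  assumes "n > 0"
  shows "span (crys_lattice n) = coord_space n"
proof
  show "span (crys_lattice n) \<subseteq> coord_space n"
    using crys_lattice_subset int_vectors_subset subspace_coord_space
    by (intro span_minimal) auto
  show "coord_space n \<subseteq> span (crys_lattice n)"
  proof
    fix x assume "x \<in> coord_space n"
    then obtain c where "x = (\<Sum>k<6 * n. c k *\<^sub>R basis_vector k)"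
      by (rule that[OF coord_space_expansion[OF assms]])
    moreover have "(\<Sum>k<6 * n. c k *\<^sub>R basis_vector k) \<in> span (lattice_basis n)"
      by (intro span_sum span_scale span_base) (auto simp: lattice_basis_def)
    ultimately have "x \<in> span (lattice_basis n)" by simp
    then show "x \<in> span (crys_lattice n)"
      by (simp add: crys_lattice_eq_int_span[OF assms] span_int_span finite_lattice_basis)
  qed
qed

section \<open>The action of the alternating group\<close>
definition affine_code :: "(nat \<Rightarrow> nat) \<Rightarrow> nat \<times> nat" where
  "affine_code = inv_into ({..<4} \<times> {..<3}) (\<lambda>(v, i). affine_perm v i)"

definition crys_act :: "nat \<Rightarrow> (nat \<Rightarrow> nat) \<Rightarrow> vector \<Rightarrow> vector" where
  "crys_act n p = (case affine_code p of (v, i) \<Rightarrow> move n v i)"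

lemma affine_code: "v < 4 \<Longrightarrow> i < 3 \<Longrightarrow> affine_code (affine_perm v i) = (v, i)"
  unfolding affine_code_def
  using inv_into_f_f[OF bij_betw_imp_inj_on[OF affine_perm_bij], of "(v, i)"] by simp

lemma alt_group_4E:
  assumes "p \<in> carrier (alt_group 4)"
  obtains v i where "v < 4" "i < 3" "p = affine_perm v i"
proof -
  have "p \<in> (\<lambda>(v, i). affine_perm v i) ` ({..<4} \<times> {..<3})"
    using assms by (simp only: bij_betw_imp_surj_on[OF affine_perm_bij])
  then obtain y where "y \<in> {..<4} \<times> {..<3}" "p = (case y of (v, i) \<Rightarrow> affine_perm v i)"
    by (rule imageE)
  then show thesis by (cases y) (auto intro: that)
qed

lemma affine_perm_in_carrier: "v < 4 \<Longrightarrow> i < 3 \<Longrightarrow> affine_perm v i \<in> carrier (alt_group 4)"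
  using bij_betw_apply[OF affine_perm_bij, of "(v, i)"] by simp

lemma crys_act: "v < 4 \<Longrightarrow> i < 3 \<Longrightarrow> crys_act n (affine_perm v i) = move n v i"
  by (simp add: crys_act_def affine_code)

lemma vec_of_in_int_vectors:
  assumes "\<And>j l. j < 3 \<Longrightarrow> l < n \<Longrightarrow> E j l \<in> \<int>" "\<And>j l. j < 3 \<Longrightarrow> l < n \<Longrightarrow> F j l \<in> \<int>"
  shows "vec_of n E F \<in> int_vectors n"
  using assms by (auto simp: int_vectors_iff vec_of_in_coord_space ecoord_vec_of fcoord_vec_of)

text \<open>
  The vectors \<open>3 e\<^sub>0\<close> of the three copies suffice: a rotation moves them to other copies, and an
  involution changes the one in the copy where it acts as \<open>a\<close>.
\<close>
lemma move_faithful: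
  assumes "n > 0" "v < 4" "i < 3" and fixed: "\<And>x. x \<in> crys_lattice n \<Longrightarrow> move n v i x = x"
  shows "v = 0 \<and> i = 0"
proof -
  define u where "u j = vec_of n (\<lambda>j' l. if j' = j \<and> l = 0 then 3 else 0) (\<lambda>_ _. 0)" for j
  have ue: "ecoord (u j) j' 0 = (if j' = j then 3 else 0)" if "j' < 3" for j j'
    using assms(1) that by (simp add: u_def ecoord_vec_of)
  have uf: "fcoord (u j) j' 0 = 0" if "j' < 3" for j j'
    using that by (simp add: u_def fcoord_vec_of)
  have u: "u j \<in> crys_lattice n" if "j < 3" for j
    using less_3_cases[OF that] unfolding crys_lattice_def
    by (auto simp: weight_def ue) (auto simp: u_def intro!: vec_of_in_int_vectors)
  have uc: "u j \<in> coord_space n" for j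
    by (simp add: u_def vec_of_in_coord_space)
  have "ecoord (move n v i (u 0)) 0 0 = ecoord (u 0) 0 0" using fixed[OF u[of 0]] by simp
  then have "source i 0 = 0"
    using ue[of "source i 0" 0] ue[of 0 0] source_less_3[of i 0]
    by (auto simp: move_coord[OF uc] local_e_def split: if_splits)
  then have i: "i = 0" using less_3_cases[OF assms(3)] by (auto simp: source_def)
  have "v = 0"
  proof (rule ccontr)
    assume "v \<noteq> 0"
    define j where "j = v - 1"
    have j: "j < 3" "role v j = 1"
      using less_4_cases[OF assms(2)] \<open>v \<noteq> 0\<close> by (auto simp: j_def role_def rot_def)
    have "fcoord (move n v i (u j)) j 0 = fcoord (u j) j 0" using fixed[OF u[OF j(1)]] by simp
    then show False
      using j ue[OF j(1), of j] uf[OF j(1), of j] by (simp add: move_coord[OF uc] i source_0 local_f_def)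
  qed
  with i show ?thesis by simp
qed

lemma faithful_lattice_module_crys:
  assumes "n > 0"
  shows "faithful_lattice_module (alt_group 4) (crys_lattice n) (crys_act n)"
proof -
  interpret A: group "alt_group 4" by (rule alt_group_is_group)
  note sp = span_crys_lattice[OF assms]
  have id: "id = affine_perm 0 0" by (simp add: affine_perm_id)
  have fin: "finite (carrier (alt_group 4))"
    using finite_permutations[of "{1..4::nat}"] by (rule rev_finite_subset) (auto simp: alt_group_carrier)
  show ?thesis
  proof
    show "finite (carrier (alt_group 4))" by (rule fin)
    show "\<exists>B. finite B \<and> independent B \<and> crys_lattice n = int_span B"
      using finite_lattice_basis independent_lattice_basis[OF assms] crys_lattice_eq_int_span[OF assms] by blast
  next
    fix p x assume "p \<in> carrier (alt_group 4)" "x \<in> crys_lattice n"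
    then show "crys_act n p x \<in> crys_lattice n"
      by (elim alt_group_4E) (simp add: crys_act move_crys_lattice)
  next
    fix x assume "x \<in> span (crys_lattice n)"
    then show "crys_act n \<one>\<^bsub>alt_group 4\<^esub> x = x"
      unfolding sp alt_group_one id by (simp add: crys_act move_0_0)
  next
    fix p q x
    assume "p \<in> carrier (alt_group 4)" "q \<in> carrier (alt_group 4)" and x: "x \<in> span (crys_lattice n)"
    then obtain v i w k where *: "v < 4" "i < 3" "p = affine_perm v i" "w < 4" "k < 3" "q = affine_perm w k"
      by (metis alt_group_4E)
    then show "crys_act n (p \<otimes>\<^bsub>alt_group 4\<^esub> q) x = crys_act n p (crys_act n q x)"
      using x unfolding sp alt_group_mult
      by (simp add: affine_perm_comp crys_act vadd_less_4 rot_less_4 move_move)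
  next
    fix p x y assume "p \<in> carrier (alt_group 4)"
    then show "crys_act n p (x + y) = crys_act n p x + crys_act n p y"
      by (elim alt_group_4E) (simp add: crys_act move_add)
  next
    fix p r x assume "p \<in> carrier (alt_group 4)"
    then show "crys_act n p (r *\<^sub>R x) = r *\<^sub>R crys_act n p x"
      by (elim alt_group_4E) (simp add: crys_act move_scaleR)
  next
    fix p assume "p \<in> carrier (alt_group 4)" and fixed: "\<And>x. x \<in> crys_lattice n \<Longrightarrow> crys_act n p x = x"
    then obtain v i where *: "v < 4" "i < 3" "p = affine_perm v i" by (metis alt_group_4E)
    then have "v = 0 \<and> i = 0" using move_faithful[OF assms *(1,2)] fixed by (simp add: crys_act)
    then show "p = \<one>\<^bsub>alt_group 4\<^esub>" using * by (simp add: alt_group_one affine_perm_id)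
  qed
qed

section \<open>The cocycle\<close>
text \<open>
  The translation by half of the last \<open>f\<close> in each copy where an involution acts as \<open>b\<close> or \<open>c\<close>.
\<close>
definition glide :: "nat \<Rightarrow> real" where
  "glide r = (if r = 2 \<or> r = 3 then 1 / 2 else 0)"

text \<open>
  The first contribution is \<open>i/3\<close> times the sum over the three copies of the fixed vector \<open>2 e\<^sub>0 + f\<^sub>0\<close>, whose
  total weight is 6; it is a cocycle that depends on the rotational part only.
\<close>
definition shift_vector :: "nat \<Rightarrow> nat \<Rightarrow> nat \<Rightarrow> vector" where
  "shift_vector n v i = vec_of n
     (\<lambda>j l. if l = 0 then 2 * real i / 3 else 0)
     (\<lambda>j l. (if l = 0 then real i / 3 else 0) + (if Suc l = n then glide (role v j) else 0))"

definition crys_cocycle :: "nat \<Rightarrow> (nat \<Rightarrow> nat) \<Rightarrow> vector set" where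
  "crys_cocycle n p = (case affine_code p of (v, i) \<Rightarrow> shift_vector n v i +o crys_lattice n)"

lemma crys_cocycle: "v < 4 \<Longrightarrow> i < 3 \<Longrightarrow> crys_cocycle n (affine_perm v i) = shift_vector n v i +o crys_lattice n"
  by (simp add: crys_cocycle_def affine_code)

lemma shift_vector_coord:
  assumes "n > 0" "j < 3"
  shows "ecoord (shift_vector n v i) j l = (if l = 0 then 2 * real i / 3 else 0)"
    and "fcoord (shift_vector n v i) j l =
      (if l = 0 then real i / 3 else 0) + (if Suc l = n then glide (role v j) else 0)"
  using assms by (auto simp: shift_vector_def ecoord_vec_of fcoord_vec_of)

lemma weight_shift_vector: "n > 0 \<Longrightarrow> weight (shift_vector n v i) = 2 * real i"
  by (simp add: weight_def shift_vector_coord)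

text \<open>
  Modulo integers \<open>glide\<close> is a homomorphism with kernel \<open>{0, 1}\<close>.  The second form serves the roles \<open>a\<close> and \<open>c\<close>,
  which change the sign of the last \<open>f\<close>.
\<close>
lemma glide_cocycle:
  assumes "r < 4" "s < 4"
  shows "glide s + glide r - glide (vadd r s) \<in> \<int>" "- glide s + glide r - glide (vadd r s) \<in> \<int>"
  using assms[THEN less_4_cases]
  by (elim disjE; hypsubst; simp only: vadd_table; simp add: glide_def)+

text \<open>
  As \<open>n\<close> is odd, the last \<open>f\<close> has an even index, so it is fixed by \<open>b\<close> and negated by \<open>a\<close> and \<open>c\<close>.
\<close>
lemma shift_vector_cocycle:
  assumes "odd n" "v < 4" "i < 3" "w < 4" "k < 3"
  shows "move n v i (shift_vector n w k) + shift_vector n v i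
    - shift_vector n (vadd v (rot i w)) ((i + k) mod 3) \<in> crys_lattice n"
proof -
  define d where "d = move n v i (shift_vector n w k) + shift_vector n v i
    - shift_vector n (vadd v (rot i w)) ((i + k) mod 3)"
  have n: "n > 0" using assms(1) by (rule odd_pos)
  \<comment> \<open>Reducing \<open>i + k\<close> modulo 3 costs \<open>q\<close> times a fixed vector of total weight 6, which lies in the lattice.\<close>
  define q where "q = (i + k) div 3"
  have ik: "real ((i + k) mod 3) = real i + real k - 3 * real q"
    unfolding q_def using div_mult_mod_eq[of "i + k" 3] by (metis add_diff_cancel_left' mult.commute of_nat_add of_nat_mult of_nat_numeral)
  have in_space: "shift_vector n w k \<in> coord_space n" for w k
    by (simp add: shift_vector_def vec_of_in_coord_space)
  have e: "ecoord d j l = (if l = 0 then 2 * real q else 0)" if "j < 3" for j l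
    using that n by (simp add: d_def move_coord[OF in_space] shift_vector_coord source_less_3 local_e_def ik field_simps)
  have f: "fcoord d j l \<in> \<int>" if j: "j < 3" for j l
  proof -
    define r s where "r = role v j" and "s = role w (source i j)"
    have rs: "r < 4" "s < 4" by (simp_all add: r_def s_def role_less_4)
    have "local_f r (ecoord (shift_vector n w k) (source i j)) (fcoord (shift_vector n w k) (source i j)) l =
      (if l = 0 then real k / 3 else 0) +
      (if Suc l = n then if r = 0 \<or> r = 2 then glide s else - glide s else 0)"
      using n assms(1) less_4_cases[OF rs(1)]
      by (auto simp: local_f_def shift_vector_coord source_less_3 s_def[symmetric])
    then have "fcoord d j l = (if l = 0 then real q else 0) + (if Suc l = n then
        (if r = 0 \<or> r = 2 then glide s else - glide s) + glide r - glide (vadd r s) else 0)"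
      using j n assms
      by (simp add: d_def move_coord[OF in_space] shift_vector_coord ik role_vadd rot_less_4 role_rot
          r_def[symmetric] s_def[symmetric] field_simps)
    then show ?thesis using glide_cocycle[OF rs] by auto
  qed
  have "d \<in> coord_space n"
    unfolding d_def by (intro subspace_diff subspace_add subspace_coord_space move_in_coord_space in_space)
  then have "d \<in> int_vectors n" using e f by (simp add: int_vectors_iff)
  moreover have "weight d / 3 \<in> \<int>" by (simp add: weight_def e)
  ultimately show ?thesis by (simp add: crys_lattice_def d_def)
qed

lemma cocycle_crys:
  assumes "odd n"
  shows "cocycle (alt_group 4) (crys_lattice n) (crys_act n) (crys_cocycle n)"
  unfolding cocycle_def
proof (intro conjI ballI)
  have n: "n > 0" using assms by (rule odd_pos)
  fix p assume "p \<in> carrier (alt_group 4)"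
  then obtain v i where p: "v < 4" "i < 3" "p = affine_perm v i" by (metis alt_group_4E)
  have "shift_vector n v i \<in> coord_space n" by (simp add: shift_vector_def vec_of_in_coord_space)
  then show "\<exists>x\<in>span (crys_lattice n). crys_cocycle n p = x +o crys_lattice n"
    unfolding span_crys_lattice[OF n] p(3) crys_cocycle[OF p(1,2)] by blast
  fix q assume "q \<in> carrier (alt_group 4)"
  then obtain w k where q: "w < 4" "k < 3" "q = affine_perm w k" by (metis alt_group_4E)
  let ?s = "shift_vector n v i" and ?t = "shift_vector n w k" and ?st = "shift_vector n (vadd v (rot i w)) ((i + k) mod 3)"
  have d: "move n v i ?t + ?s - ?st \<in> crys_lattice n" (is "?d \<in> _")
    using shift_vector_cocycle assms p q by blast
  have "?st +o crys_lattice n = move n v i ` (?t +o crys_lattice n) + (?s +o crys_lattice n)"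
  proof (intro equalityI subsetI)
    fix x assume "x \<in> ?st +o crys_lattice n"
    then obtain m where m: "m \<in> crys_lattice n" "x = ?st + m" by (auto simp: elt_set_plus_def)
    have "x = move n v i (?t + 0) + (?s + (m - ?d))" using m(2) by simp
    moreover have "m - ?d \<in> crys_lattice n" using m(1) d by (rule crys_lattice_diff)
    ultimately show "x \<in> move n v i ` (?t +o crys_lattice n) + (?s +o crys_lattice n)"
      using crys_lattice_0 by (simp only: set_plus_intro imageI set_plus_intro2)
  next
    fix x assume "x \<in> move n v i ` (?t +o crys_lattice n) + (?s +o crys_lattice n)"
    then obtain m m' where m: "m \<in> crys_lattice n" "m' \<in> crys_lattice n" "x = move n v i (?t + m) + (?s + m')"
      by (auto simp: elt_set_plus_def set_plus_def)
    have "x = ?st + (?d + move n v i m + m')" using m(3) by (simp add: move_add)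
    moreover have "?d + move n v i m + m' \<in> crys_lattice n"
      by (intro crys_lattice_add d move_crys_lattice m p)
    ultimately show "x \<in> ?st +o crys_lattice n" unfolding elt_set_plus_def by blast
  qed
  then show "crys_cocycle n (p \<otimes>\<^bsub>alt_group 4\<^esub> q) = crys_act n p ` crys_cocycle n q + crys_cocycle n p"
    using p q by (simp add: alt_group_mult affine_perm_comp crys_cocycle crys_act vadd_less_4 rot_less_4)
qed

lemma crystallographic_crys:
  assumes "odd n"
  shows "crystallographic (alt_group 4) (crys_lattice n) (crys_act n) (crys_cocycle n)"
  using faithful_lattice_module_crys[of n] cocycle_crys[of n] assms odd_pos
  by (simp add: crystallographic_def crystallographic_axioms_def)

section \<open>Torsion-freeness\<close>
text \<open>
  The shift has weight \<open>2 i\<close>, whereas the weights of lattice vectors are multiples of 3.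
\<close>
lemma weight_nonzero:
  assumes "n > 0" "i < 3" "i \<noteq> 0" "m \<in> crys_lattice n"
  shows "weight (shift_vector n v i + m) \<noteq> 0"
proof
  assume "weight (shift_vector n v i + m) = 0"
  moreover obtain z :: int where "weight m / 3 = of_int z"
    using assms(4) by (auto simp: crys_lattice_def elim: Ints_cases)
  ultimately have "of_int (2 * int i + 3 * z) = (0 :: real)"
    using assms(1) by (simp add: weight_shift_vector field_simps)
  then have "2 * int i + 3 * z = 0" by (simp only: of_int_eq_0_iff)
  then show False using assms(2,3) by presburger
qed

text \<open>
  Every invariant functional vanishes on elements of finite order.  The functionals are the weight
  for elements with a rotational part, the coordinate of the last \<open>f\<close> in a copy where the element acts as
  \<open>b\<close> for involutions, and all coordinates for translations.
\<close>
lemma torsionfree_crys: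
  assumes "odd n"
  shows "torsionfree (Crys (alt_group 4) (crys_act n) (crys_cocycle n))"
proof -
  interpret crystallographic "alt_group 4" "crys_lattice n" "crys_act n" "crys_cocycle n"
    by (rule crystallographic_crys[OF assms])
  have n: "n > 0" using assms by (rule odd_pos)
  note sp = span_crys_lattice[OF n]
  have "P = \<one>\<^bsub>\<Gamma>\<^esub>" if "P \<in> carrier \<Gamma>" "k > 0" "P [^]\<^bsub>\<Gamma>\<^esub> k = \<one>\<^bsub>\<Gamma>\<^esub>" for P and k :: nat
  proof -
    obtain p x where P: "P = (p, x)" by fastforce
    have px: "(p, x) \<in> carrier \<Gamma>" using that(1) P by simp
    then obtain v i where p: "v < 4" "i < 3" "p = affine_perm v i" unfolding carrier_\<Gamma> by (metis alt_group_4E)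
    then obtain m where m: "m \<in> crys_lattice n" "x = shift_vector n v i + m"
      using px by (auto simp: carrier_\<Gamma> crys_cocycle elt_set_plus_def)
    have vanish: "\<psi> x = 0" if "linear \<psi>" "\<And>z. z \<in> coord_space n \<Longrightarrow> \<psi> (move n v i z) = \<psi> z" for \<psi> :: "vector \<Rightarrow> real"
      using infinite_order_if_invariant_functional[OF px that(1), of k] that(2) \<open>k > 0\<close> \<open>P [^]\<^bsub>\<Gamma>\<^esub> k = \<one>\<^bsub>\<Gamma>\<^esub>\<close> p
      unfolding P sp by (auto simp: crys_act)
    have i: "i = 0"
    proof (rule ccontr)
      assume "i \<noteq> 0"
      moreover have "weight x = 0"
        by (rule vanish) (auto intro!: linearI simp: weight_move p)
      ultimately show False using weight_nonzero[OF n p(2) _ m(1)] m(2) by simp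
    qed
    have v: "v = 0"
    proof (rule ccontr)
      assume "v \<noteq> 0"
      define j where "j = (v + 1) mod 3"
      have j: "j < 3" "role v j = 2"
        using less_4_cases[OF p(1)] \<open>v \<noteq> 0\<close> by (auto simp: j_def role_def rot_def)
      obtain l where l: "n = Suc l" "even l" using assms by (metis oddE even_mult_iff even_numeral Suc_eq_plus1)
      have "fcoord x j l = 0"
      proof (rule vanish)
        show "linear (\<lambda>z. fcoord z j l)" by (auto intro!: linearI)
        show "fcoord (move n v i z) j l = fcoord z j l" if "z \<in> coord_space n" for z
          using move_coord(2)[OF that j(1), of v i l] that j l
          by (simp add: i source_0 local_f_def coord_space_iff)
      qed
      moreover have "fcoord x j l = 1 / 2 + fcoord m j l"
        using j l n i by (simp add: m(2) shift_vector_coord glide_def)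
      moreover have "fcoord m j l \<in> \<int>"
        using m(1) j by (simp add: crys_lattice_def int_vectors_iff)
      ultimately have "1 / 2 \<in> (\<int> :: real set)" by (metis Ints_minus add_eq_0_iff minus_minus)
      then show False by (auto elim!: Ints_cases simp: field_simps)
    qed
    have "x = 0"
    proof (rule poly_mapping_eqI)
      fix k
      have "Poly_Mapping.lookup x k = 0"
        by (rule vanish) (auto intro!: linearI simp: i v move_0_0 lookup_add lookup_scaleR)
      then show "Poly_Mapping.lookup x k = Poly_Mapping.lookup 0 k" by simp
    qed
    then show ?thesis using P p i v by (simp add: one_\<Gamma> alt_group_one affine_perm_id)
  qed
  then show ?thesis unfolding torsionfree_def by blast
qed

text \<open>
  The weight is invariant, so coboundaries have weight divisible by 3.
\<close>
lemma not_coboundary_crys: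
  assumes "odd n"
  shows "\<not> coboundary (alt_group 4) (crys_lattice n) (crys_act n) (crys_cocycle n)"
proof
  have n: "n > 0" using assms by (rule odd_pos)
  assume "coboundary (alt_group 4) (crys_lattice n) (crys_act n) (crys_cocycle n)"
  then obtain z where z: "z \<in> coord_space n"
    "crys_cocycle n (affine_perm 0 1) = (crys_act n (affine_perm 0 1) z - z) +o crys_lattice n"
    unfolding coboundary_def span_crys_lattice[OF n] using affine_perm_in_carrier[of 0 1] by auto
  have "move n 0 1 z - z \<in> shift_vector n 0 1 +o crys_lattice n"
    using z(2) crys_lattice_0[of n] by (auto simp: crys_cocycle crys_act elt_set_plus_def intro: bexI[of _ 0])
  then obtain m where "m \<in> crys_lattice n" "move n 0 1 z - z = shift_vector n 0 1 + m"
    by (auto simp: elt_set_plus_def)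
  then have "weight (move n 0 1 z - z) \<noteq> 0" using weight_nonzero[OF n, of 1 m 0] by simp
  then show False using z(1) by (simp add: weight_move)
qed

section \<open>Endomorphisms modulo 2\<close>
definition even_vectors :: "nat \<Rightarrow> vector set" where
  "even_vectors n = {x. (1 / 2) *\<^sub>R x \<in> int_vectors n}"

text \<open>
  The vectors that lie in the span of the \<open>f\<^sub>l\<close> modulo 2.  They are characterised by the action alone
  (\<open>even_tops_iff\<close>), which is why equivariant maps preserve them.
\<close>
definition even_tops :: "nat \<Rightarrow> vector set" where
  "even_tops n = {x \<in> int_vectors n. \<forall>j<3. \<forall>l. ecoord x j l / 2 \<in> \<int>}"

definition difference_closed :: "vector set \<Rightarrow> bool" where
  "difference_closed S \<longleftrightarrow> 0 \<in> S \<and> (\<forall>x\<in>S. \<forall>y\<in>S. x - y \<in> S)"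

lemma difference_closed_add: "difference_closed S \<Longrightarrow> x \<in> S \<Longrightarrow> y \<in> S \<Longrightarrow> x + y \<in> S"
  unfolding difference_closed_def by (metis diff_0 diff_minus_eq_add)

lemma difference_closed_sum: "difference_closed S \<Longrightarrow> (\<And>i. i \<in> I \<Longrightarrow> f i \<in> S) \<Longrightarrow> sum f I \<in> S"
  by (induction I rule: infinite_finite_induct) (auto simp: difference_closed_add, auto simp: difference_closed_def)

lemma difference_closed_scaleR:
  assumes S: "difference_closed S" and "x \<in> S" "r \<in> \<int>"
  shows "r *\<^sub>R x \<in> S"
proof -
  have nat: "of_nat k *\<^sub>R x \<in> S" for k
    by (induction k) (use assms in \<open>auto simp: scaleR_add_left difference_closed_add\<close>, simp add: S[unfolded difference_closed_def])
  obtain z :: int where z: "r = of_int z" using assms(3) by (auto elim: Ints_cases)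
  show ?thesis
  proof (cases "z \<ge> 0")
    case True
    then show ?thesis using nat[of "nat z"] z by simp
  next
    case False
    then have "r *\<^sub>R x = 0 - of_nat (nat (- z)) *\<^sub>R x" using z by simp
    then show ?thesis using nat[of "nat (- z)"] S by (metis difference_closed_def)
  qed
qed

lemma difference_closed_vectors:
  "difference_closed (int_vectors n)" "difference_closed (even_vectors n)" "difference_closed (even_tops n)"
  by (auto simp: difference_closed_def even_vectors_def even_tops_def scaleR_diff_right diff_divide_distrib
      int_vectors_0 int_vectors_diff)

lemma even_vectors_iff:
  "x \<in> even_vectors n \<longleftrightarrow> x \<in> coord_space n \<and>
     (\<forall>j<3. \<forall>l. ecoord x j l / 2 \<in> \<int> \<and> fcoord x j l / 2 \<in> \<int>)"
  by (simp add: even_vectors_def int_vectors_iff coord_space_iff)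

lemma Ints_double: "a / 2 \<in> \<int> \<Longrightarrow> (a :: real) \<in> \<int>"
  using Ints_add[of "a / 2" "a / 2"] by simp

lemma even_vectors_subset: "even_vectors n \<subseteq> even_tops n"
  by (auto simp: even_vectors_iff even_tops_def int_vectors_iff) (metis Ints_double)+

lemma twice_even: "x \<in> int_vectors n \<Longrightarrow> 2 *\<^sub>R x \<in> even_vectors n"
  by (simp add: even_vectors_def)

lemma parity_sign:
  assumes "(a :: real) \<in> \<int>"
  shows "((-1) ^ l * a - a) / 2 \<in> \<int>" "((-1) ^ l * a + a) / 2 \<in> \<int>"
    and "(-1) ^ l * a / 2 \<in> \<int> \<longleftrightarrow> a / 2 \<in> \<int>"
  using assms by (cases "even l"; simp)+

lemma parity_add: "(b :: real) / 2 \<in> \<int> \<Longrightarrow> (a + b) / 2 \<in> \<int> \<longleftrightarrow> a / 2 \<in> \<int>"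
  using Ints_add[of "a / 2" "b / 2"] Ints_diff[of "(a + b) / 2" "b / 2"] by (auto simp: add_divide_distrib)

lemma parity_minus: "(a :: real) / 2 \<in> \<int> \<Longrightarrow> (-1) * a / 2 \<in> \<int>"
  using Ints_minus[of "a / 2"] by simp

text \<open>
  On the \<open>e\<close>-coordinates modulo 2, \<open>a - 1\<close> and \<open>c - 1\<close> are injective, the latter being the sum of an identity and
  a nilpotent shift, while \<open>b - 1\<close> is a shift whose kernel is spanned by \<open>e\<^sub>0\<close>.
\<close>
lemma local_fixed_mod_2:
  assumes A: "\<And>l. A l \<in> \<int>" "\<And>l. l \<ge> n \<Longrightarrow> A l = 0" and B: "\<And>l. B l \<in> \<int>"
    and r: "r = 1 \<or> r = 2 \<or> r = 3"
  shows "(\<forall>l. (local_e r A l - A l) / 2 \<in> \<int> \<and> (local_f r A B l - B l) / 2 \<in> \<int>) \<longleftrightarrow>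
    (\<forall>l. A l / 2 \<in> \<int> \<or> r = 2 \<and> l = 0)"
proof -
  have e: "(local_e r A l - A l) / 2 \<in> \<int>" for l
    using parity_sign(1)[OF A(1), of l l] by (auto simp: local_e_def)
  have f1: "(local_f 1 A B l - B l) / 2 \<in> \<int> \<longleftrightarrow> A l / 2 \<in> \<int>" for l
  proof -
    have eq: "local_f 1 A B l - B l = A l + (-1) * ((-1) ^ l * B l + B l)" by (simp add: local_f_def)
    show ?thesis unfolding eq by (rule parity_add) (intro parity_minus parity_sign(2) B)
  qed
  have f2: "(local_f 2 A B l - B l) / 2 \<in> \<int> \<longleftrightarrow> A (Suc l) / 2 \<in> \<int>" for l
  proof -
    have eq: "local_f 2 A B l - B l = (-1) ^ l * A (Suc l) + ((-1) ^ l * B l - B l)"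
      by (simp add: local_f_def algebra_simps)
    show ?thesis unfolding eq parity_add[OF parity_sign(1)[OF B]] by (rule parity_sign(3)[OF A(1)])
  qed
  have f3: "(local_f 3 A B l - B l) / 2 \<in> \<int> \<longleftrightarrow> (A l - A (Suc l)) / 2 \<in> \<int>" for l
  proof -
    have eq: "local_f 3 A B l - B l = (A l - A (Suc l)) + (((-1) ^ l * A l - A l) + (-2) * B l)"
      by (simp add: local_f_def algebra_simps)
    have "((-2) * B l) / 2 \<in> \<int>" using B[of l] by simp
    then have "(((-1) ^ l * A l - A l) + (-2) * B l) / 2 \<in> \<int>"
      using parity_add parity_sign(1)[OF A(1)] by blast
    then show ?thesis unfolding eq by (rule parity_add)
  qed
  \<comment> \<open>Consecutive coordinates have equal parity, and the coordinates vanish from \<open>n\<close> on.\<close>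
  have down: "A l / 2 \<in> \<int>" if "\<forall>l. (A l - A (Suc l)) / 2 \<in> \<int>" for l
  proof (cases "l \<le> n")
    case True
    then show ?thesis
    proof (induction rule: inc_induct)
      case base
      then show ?case using A(2)[of n] by simp
    next
      case (step m)
      then show ?case using parity_add[of "A (Suc m)" "A m - A (Suc m)"] that by simp
    qed
  qed (use A(2)[of l] in simp)
  from r consider "r = 1" | "r = 2" | "r = 3" by blast
  then show ?thesis
  proof cases
    case 1
    then show ?thesis using e f1 by simp
  next
    case 2
    have "(\<forall>l. A (Suc l) / 2 \<in> \<int>) \<longleftrightarrow> (\<forall>l. A l / 2 \<in> \<int> \<or> l = 0)"
      proof (intro iffI allI)
      fix l assume "\<forall>l. A (Suc l) / 2 \<in> \<int>"
      then show "A l / 2 \<in> \<int> \<or> l = 0" by (cases l) auto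
    next
      fix l assume "\<forall>l. A l / 2 \<in> \<int> \<or> l = 0"
      then show "A (Suc l) / 2 \<in> \<int>" using spec[of _ "Suc l"] by blast
    qed
    then show ?thesis using 2 e f2 by simp
  next
    case 3
    have "(\<forall>l. (A l - A (Suc l)) / 2 \<in> \<int>) \<longleftrightarrow> (\<forall>l. A l / 2 \<in> \<int>)"
    proof
      assume "\<forall>l. (A l - A (Suc l)) / 2 \<in> \<int>"
      then show "\<forall>l. A l / 2 \<in> \<int>" using down by blast
    next
      assume *: "\<forall>l. A l / 2 \<in> \<int>"
      then show "\<forall>l. (A l - A (Suc l)) / 2 \<in> \<int>"
        unfolding diff_divide_distrib by (intro allI Ints_diff) (rule spec[OF *])+
    qed
    then show ?thesis using 3 e f3 by simp
  qed
qed

lemma move_fixed_mod_2: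
  assumes x: "x \<in> int_vectors n" and v: "v = 1 \<or> v = 2 \<or> v = 3"
  shows "move n v 0 x - x \<in> even_vectors n \<longleftrightarrow>
    (\<forall>j<3. \<forall>l. ecoord x j l / 2 \<in> \<int> \<or> role v j = 2 \<and> l = 0)"
proof -
  have xc: "x \<in> coord_space n" using x int_vectors_subset by blast
  have "(\<forall>l. (local_e (role v j) (ecoord x j) l - ecoord x j l) / 2 \<in> \<int> \<and>
          (local_f (role v j) (ecoord x j) (fcoord x j) l - fcoord x j l) / 2 \<in> \<int>) \<longleftrightarrow>
        (\<forall>l. ecoord x j l / 2 \<in> \<int> \<or> role v j = 2 \<and> l = 0)" if "j < 3" for j
  proof (rule local_fixed_mod_2)
    show "ecoord x j l \<in> \<int>" "fcoord x j l \<in> \<int>" for l using x that by (simp_all add: int_vectors_iff)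
    show "ecoord x j l = 0" if "l \<ge> n" for l using xc that \<open>j < 3\<close> by (simp add: coord_space_iff)
    show "role v j = 1 \<or> role v j = 2 \<or> role v j = 3"
      using v less_3_cases[OF that] by (auto simp: role_def rot_def)
  qed
  moreover have "move n v 0 x - x \<in> coord_space n"
    by (intro subspace_diff subspace_coord_space move_in_coord_space xc)
  ultimately show ?thesis
    by (auto simp: even_vectors_iff move_coord[OF xc] source_0)
qed

text \<open>
  The exceptional lines of the first two involutions lie in different copies, so these two involutions
  together leave no exception.
\<close>
lemma even_tops_iff:
  "x \<in> even_tops n \<longleftrightarrow> x \<in> int_vectors n \<and>
     move n 1 0 x - x \<in> even_vectors n \<and> move n 2 0 x - x \<in> even_vectors n"
proof -
  have "role 1 j = 2 \<longleftrightarrow> j = 2" "role 2 j = 2 \<longleftrightarrow> j = 0" if "j < 3" for j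
    using less_3_cases[OF that] by (auto simp: role_def rot_def)
  then have "(\<forall>l. ecoord x j l / 2 \<in> \<int>) \<longleftrightarrow>
      (\<forall>l. ecoord x j l / 2 \<in> \<int> \<or> role 1 j = 2 \<and> l = 0) \<and> (\<forall>l. ecoord x j l / 2 \<in> \<int> \<or> role 2 j = 2 \<and> l = 0)"
    if "j < 3" for j using that by auto
  then show ?thesis
    using move_fixed_mod_2[of x n 1] move_fixed_mod_2[of x n 2] unfolding even_tops_def by auto
qed

definition e_unit :: "nat \<Rightarrow> nat \<Rightarrow> nat \<Rightarrow> vector" where
  "e_unit n j l = vec_of n (\<lambda>j' l'. if j' = j \<and> l' = l then 1 else 0) (\<lambda>_ _. 0)"

definition f_unit :: "nat \<Rightarrow> nat \<Rightarrow> nat \<Rightarrow> vector" where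
  "f_unit n j l = vec_of n (\<lambda>_ _. 0) (\<lambda>j' l'. if j' = j \<and> l' = l then 1 else 0)"

lemma unit_in_int_vectors: "e_unit n j l \<in> int_vectors n" "f_unit n j l \<in> int_vectors n"
  unfolding e_unit_def f_unit_def by (intro vec_of_in_int_vectors; simp)+

lemma unit_coord:
  assumes "l < n" "j' < 3"
  shows "ecoord (e_unit n j l) j' l' = (if j' = j \<and> l' = l then 1 else 0)" "fcoord (e_unit n j l) j' l' = 0"
    "fcoord (f_unit n j l) j' l' = (if j' = j \<and> l' = l then 1 else 0)" "ecoord (f_unit n j l) j' l' = 0"
  using assms by (auto simp: e_unit_def f_unit_def ecoord_vec_of fcoord_vec_of)

lemma coord_sum [simp]:
  "ecoord (sum h I) j l = (\<Sum>i\<in>I. ecoord (h i) j l)" "fcoord (sum h I) j l = (\<Sum>i\<in>I. fcoord (h i) j l)"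
  by (simp_all add: ecoord_def fcoord_def lookup_sum)

lemma unit_expansion:
  assumes "x \<in> coord_space n"
  shows "x = (\<Sum>j<3. \<Sum>l<n. ecoord x j l *\<^sub>R e_unit n j l + fcoord x j l *\<^sub>R f_unit n j l)"
proof (rule vector_eqI)
  have delta: "(\<Sum>j<3. \<Sum>l<n. a j l * (if j' = j \<and> l' = l then 1 else 0)) = (if l' < n then a j' l' else 0)"
    if "j' < 3" for a :: "nat \<Rightarrow> nat \<Rightarrow> real" and j' l'
  proof -
    have "(\<Sum>l<n. a j l * (if j' = j \<and> l' = l then 1 else 0)) = (if j' = j then if l' < n then a j l' else 0 else 0)" for j
      by (cases "j' = j") (simp_all add: if_distrib cong: if_cong)
    then show ?thesis using that by simp
  qed
  fix j' l' :: nat assume j': "j' < 3"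
  have z: "l' \<ge> n \<Longrightarrow> ecoord x j' l' = 0 \<and> fcoord x j' l' = 0" using assms j' by (simp add: coord_space_iff)
  show "ecoord x j' l' = ecoord (\<Sum>j<3. \<Sum>l<n. ecoord x j l *\<^sub>R e_unit n j l + fcoord x j l *\<^sub>R f_unit n j l) j' l'"
    using z delta[OF j', of "ecoord x" l'] j' by (simp add: unit_coord)
  show "fcoord x j' l' = fcoord (\<Sum>j<3. \<Sum>l<n. ecoord x j l *\<^sub>R e_unit n j l + fcoord x j l *\<^sub>R f_unit n j l) j' l'"
    using z delta[OF j', of "fcoord x" l'] j' by (simp add: unit_coord)
qed

lemma generated_by_units:
  assumes "difference_closed S" "x \<in> coord_space n"
    and "\<And>j l. j < 3 \<Longrightarrow> l < n \<Longrightarrow> ecoord x j l *\<^sub>R e_unit n j l \<in> S"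
    and "\<And>j l. j < 3 \<Longrightarrow> l < n \<Longrightarrow> fcoord x j l *\<^sub>R f_unit n j l \<in> S"
  shows "x \<in> S"
proof -
  have "(\<Sum>j<3. \<Sum>l<n. ecoord x j l *\<^sub>R e_unit n j l + fcoord x j l *\<^sub>R f_unit n j l) \<in> S"
    by (intro difference_closed_sum[OF assms(1)] difference_closed_add[OF assms(1)] assms(3,4)) simp_all
  then show ?thesis using unit_expansion[OF assms(2)] by simp
qed

lemma unit_in_coord_space: "e_unit n j l \<in> coord_space n" "f_unit n j l \<in> coord_space n"
  using unit_in_int_vectors int_vectors_subset by blast+

text \<open>
  The second involution is the one that acts as \<open>b\<close> in copy 0.
\<close>
lemma even_tops_except_first:
  assumes "x \<in> int_vectors n" "move n 2 0 x - x \<in> even_vectors n" "ecoord x 0 0 / 2 \<in> \<int>"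
  shows "x \<in> even_tops n"
proof -
  have "role 2 j = 2 \<longleftrightarrow> j = 0" if "j < 3" for j
    using less_3_cases[OF that] by (auto simp: role_def rot_def)
  then show ?thesis using assms move_fixed_mod_2[of x n 2] by (auto simp: even_tops_def)
qed

lemma first_unit_fixed_mod_2: "n > 0 \<Longrightarrow> move n 2 0 (e_unit n 0 0) - e_unit n 0 0 \<in> even_vectors n"
  by (subst move_fixed_mod_2[OF unit_in_int_vectors(1)]) (auto simp: unit_coord role_def rot_def)

text \<open>
  The relation \<open>(b - 1) e\<^bsub>l+1\<^esub> = (a - 1) e\<^sub>l\<close> modulo 2, which links the \<open>e\<^sub>l\<close> to a chain.
\<close>
lemma consecutive_units:
  assumes "Suc l < n"
  shows "move n 2 0 (e_unit n 0 (Suc l)) - e_unit n 0 (Suc l) - (move n 1 0 (e_unit n 0 l) - e_unit n 0 l)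
    \<in> even_vectors n" (is "?d \<in> _")
proof -
  have c: "?d \<in> coord_space n"
    by (intro subspace_diff subspace_coord_space move_in_coord_space unit_in_coord_space)
  have "ecoord ?d j k / 2 \<in> \<int> \<and> fcoord ?d j k / 2 \<in> \<int>" if "j < 3" for j k
    using less_3_cases[OF that] assms
    by (elim disjE; cases "even k")
      (auto simp: move_coord[OF unit_in_coord_space(1)] unit_coord source_0 role_def rot_def local_e_def local_f_def)
  then show ?thesis using c by (simp add: even_vectors_iff)
qed

lemma f_unit_mod_2:
  assumes "l < n"
  shows "f_unit n 0 l - (move n 1 0 (e_unit n 0 l) - e_unit n 0 l) \<in> even_vectors n" (is "?d \<in> _")
proof -
  have c: "?d \<in> coord_space n"
    by (intro subspace_diff subspace_coord_space move_in_coord_space unit_in_coord_space)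
  have "ecoord ?d j k / 2 \<in> \<int> \<and> fcoord ?d j k / 2 \<in> \<int>" if "j < 3" for j k
    using less_3_cases[OF that] assms
    by (elim disjE; cases "even k")
      (auto simp: move_coord[OF unit_in_coord_space(1)] unit_coord source_0 role_def rot_def local_e_def local_f_def)
  then show ?thesis using c by (simp add: even_vectors_iff)
qed

lemma source_eq_0_iff: "i < 3 \<Longrightarrow> j < 3 \<Longrightarrow> source i j = 0 \<longleftrightarrow> j = i"
  by (drule less_3_cases, drule less_3_cases) (elim disjE; simp add: source_def)

lemma move_unit:
  assumes "j < 3" "l < n"
  shows "move n 0 j (e_unit n 0 l) = e_unit n j l" "move n 0 j (f_unit n 0 l) = f_unit n j l"
  by (rule vector_eqI; use assms source_eq_0_iff in \<open>simp add: move_coord[OF unit_in_coord_space(1)]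
      move_coord[OF unit_in_coord_space(2)] unit_coord role_0 local_e_def local_f_def source_less_3\<close>)+

lemma move_even:
  shows "x \<in> even_vectors n \<Longrightarrow> move n 0 j x \<in> even_vectors n"
    and "x \<in> even_tops n \<Longrightarrow> move n 0 j x \<in> even_tops n"
proof -
  show "x \<in> even_vectors n \<Longrightarrow> move n 0 j x \<in> even_vectors n"
    unfolding even_vectors_def using move_int_vectors[of "(1 / 2) *\<^sub>R x" n 0 j] by (simp add: move_scaleR)
  assume x: "x \<in> even_tops n"
  then have "x \<in> coord_space n" using int_vectors_subset by (auto simp: even_tops_def)
  then show "move n 0 j x \<in> even_tops n"
    using x move_int_vectors by (auto simp: even_tops_def move_coord role_0 local_e_def source_less_3)
qed

text \<open>
  Three times a projection of \<open>crys_lattice n\<close> onto a direct summand extends to all integral vectors,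
  because the index of \<open>crys_lattice n\<close> is 3; it satisfies \<open>q\<^sup>2 = 3 q\<close>.  Since 3 is odd, it is as good as a
  projection modulo 2.
\<close>
locale quasi_projection =
  fixes n :: nat and q :: "vector \<Rightarrow> vector"
  assumes q_int: "x \<in> int_vectors n \<Longrightarrow> q x \<in> int_vectors n"
    and q_add: "x \<in> int_vectors n \<Longrightarrow> y \<in> int_vectors n \<Longrightarrow> q (x + y) = q x + q y"
    and q_move: "x \<in> int_vectors n \<Longrightarrow> v < 4 \<Longrightarrow> i < 3 \<Longrightarrow> q (move n v i x) = move n v i (q x)"
    and q_q: "x \<in> int_vectors n \<Longrightarrow> q (q x) = 3 *\<^sub>R q x"
begin

lemma q_0: "q 0 = 0"
  using q_add[OF int_vectors_0 int_vectors_0] by simp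

lemma q_diff: "x \<in> int_vectors n \<Longrightarrow> y \<in> int_vectors n \<Longrightarrow> q (x - y) = q x - q y"
  using q_add[of "x - y" y] int_vectors_diff by simp

lemma q_even: "x \<in> even_vectors n \<Longrightarrow> q x \<in> even_vectors n"
proof -
  assume x: "x \<in> even_vectors n"
  define y where "y = (1 / 2) *\<^sub>R x"
  have y: "y \<in> int_vectors n" using x by (simp add: y_def even_vectors_def)
  have "x = y + y" by (simp add: y_def flip: scaleR_add_left)
  then have "q x = 2 *\<^sub>R q y" using q_add[OF y y] by (simp add: scaleR_2)
  then show ?thesis using twice_even q_int y by simp
qed

lemma q_move_diff:
  "x \<in> int_vectors n \<Longrightarrow> v < 4 \<Longrightarrow> q (move n v 0 x - x) = move n v 0 (q x) - q x"
  using q_diff[OF move_int_vectors] q_move by simp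

lemma q_even_tops: "x \<in> even_tops n \<Longrightarrow> q x \<in> even_tops n"
  unfolding even_tops_iff
  using q_int q_even[of "move n 1 0 x - x"] q_even[of "move n 2 0 x - x"] q_move_diff[of x 1] q_move_diff[of x 2]
  by simp

lemma move_diff_q_even:
  assumes "x \<in> int_vectors n" "y \<in> int_vectors n" "v < 4" "q y \<in> even_tops n"
    and "move n v 0 x - x - (move n 1 0 y - y) \<in> even_vectors n"
  shows "move n v 0 (q x) - q x \<in> even_vectors n"
proof -
  have "q (move n v 0 x - x - (move n 1 0 y - y)) = q (move n v 0 x - x) - q (move n 1 0 y - y)"
    using assms(1,2) by (intro q_diff int_vectors_diff move_int_vectors)
  also have "\<dots> = (move n v 0 (q x) - q x) - (move n 1 0 (q y) - q y)"
    using assms by (simp add: q_move_diff)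
  finally have "(move n v 0 (q x) - q x) - (move n 1 0 (q y) - q y) \<in> even_vectors n"
    using q_even[OF assms(5)] by simp
  moreover have "move n 1 0 (q y) - q y \<in> even_vectors n"
    using assms(4) by (simp add: even_tops_iff)
  ultimately show ?thesis
    using difference_closed_add[OF difference_closed_vectors(2)] by (metis diff_add_cancel)
qed

lemma q_first_unit_fixed_mod_2:
  assumes "n > 0"
  shows "move n 2 0 (q (e_unit n 0 0)) - q (e_unit n 0 0) \<in> even_vectors n"
  using q_even[OF first_unit_fixed_mod_2[OF assms]] q_move_diff[OF unit_in_int_vectors(1), of 2 0 0] by simp

text \<open>
  By induction along the chain of the \<open>e\<^sub>l\<close>: if \<open>q\<close> kills \<open>e\<^sub>l\<close> modulo 2 and modulo the \<open>f\<close>s, then \<open>q e\<^bsub>l+1\<^esub>\<close> is killed by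
  \<open>b - 1\<close> and hence congruent to 0 or \<open>e\<^sub>0\<close>.  In the second case, applying \<open>q\<close> again gives
  \<open>3 q e\<^bsub>l+1\<^esub> = q e\<^sub>0 = 0\<close>, a contradiction.
\<close>
lemma q_e_unit:
  assumes first: "q (e_unit n 0 0) \<in> even_tops n" and "l < n"
  shows "q (e_unit n 0 l) \<in> even_tops n"
  using assms(2)
proof (induction l)
  case 0
  then show ?case using first by simp
next
  case (Suc l)
  let ?z = "q (e_unit n 0 (Suc l))" and ?u = "e_unit n 0 0"
  have n: "n > 0" using Suc by simp
  have z: "?z \<in> int_vectors n" by (intro q_int unit_in_int_vectors)
  have fixed: "move n 2 0 ?z - ?z \<in> even_vectors n"
    by (rule move_diff_q_even[OF unit_in_int_vectors(1) unit_in_int_vectors(1), of 2 0 l])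
      (use Suc consecutive_units in simp_all)
  have "ecoord ?z 0 0 / 2 \<in> \<int>"
  proof (rule ccontr)
    assume odd: "ecoord ?z 0 0 / 2 \<notin> \<int>"
    have int: "ecoord ?z 0 0 \<in> \<int>" using z by (simp add: int_vectors_iff)
    from int obtain m :: int where m: "ecoord ?z 0 0 = of_int m" by (auto elim: Ints_cases)
    then have "odd m" using odd by (auto elim!: evenE)
    then have "(ecoord ?z 0 0 - 1) / 2 \<in> \<int>" using m by (auto elim!: oddE)
    moreover have "move n 2 0 (?z - ?u) - (?z - ?u) \<in> even_vectors n"
    proof -
      have "move n 2 0 (?z - ?u) = move n 2 0 ?z - move n 2 0 ?u"
        using move_add[of n 2 0 "?z - ?u" ?u] by simp
      then have eq: "move n 2 0 (?z - ?u) - (?z - ?u) = (move n 2 0 ?z - ?z) - (move n 2 0 ?u - ?u)" by simp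
      show ?thesis
        unfolding eq using fixed first_unit_fixed_mod_2[OF n] difference_closed_vectors(2)[of n]
        unfolding difference_closed_def by blast
    qed
    ultimately have "?z - ?u \<in> even_tops n"
      using n z by (intro even_tops_except_first int_vectors_diff unit_in_int_vectors) (simp_all add: unit_coord)
    then have "q (?z - ?u) \<in> even_tops n" by (rule q_even_tops)
    then have "q ?z - q ?u \<in> even_tops n" using q_diff[OF z unit_in_int_vectors(1)] by simp
    then have "q ?z \<in> even_tops n"
      using first difference_closed_add[OF difference_closed_vectors(3)] by (metis diff_add_cancel)
    then have "3 * ecoord ?z 0 0 / 2 \<in> \<int>"
      using q_q[OF unit_in_int_vectors(1)] by (auto simp: even_tops_def)
    then have "3 * ecoord ?z 0 0 / 2 - ecoord ?z 0 0 \<in> \<int>" using int by (rule Ints_diff)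
    moreover have "3 * ecoord ?z 0 0 / 2 - ecoord ?z 0 0 = ecoord ?z 0 0 / 2" by simp
    ultimately show False using odd by simp
  qed
  then show ?case using even_tops_except_first z fixed by blast
qed

lemma q_f_unit:
  assumes first: "q (e_unit n 0 0) \<in> even_tops n" and "l < n"
  shows "q (f_unit n 0 l) \<in> even_vectors n"
proof -
  let ?u = "e_unit n 0 l"
  have "q (f_unit n 0 l - (move n 1 0 ?u - ?u)) = q (f_unit n 0 l) - (move n 1 0 (q ?u) - q ?u)"
    using q_diff[OF unit_in_int_vectors(2) int_vectors_diff[OF move_int_vectors]] q_move_diff[of ?u 1]
    by (simp add: unit_in_int_vectors)
  then have "q (f_unit n 0 l) - (move n 1 0 (q ?u) - q ?u) \<in> even_vectors n"
    using q_even[OF f_unit_mod_2[OF assms(2)]] by simp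
  moreover have "move n 1 0 (q ?u) - q ?u \<in> even_vectors n"
    using q_e_unit[OF assms] by (simp add: even_tops_iff)
  ultimately show ?thesis
    using difference_closed_add[OF difference_closed_vectors(2)] by (metis diff_add_cancel)
qed

lemma q_all_units:
  assumes "q (e_unit n 0 0) \<in> even_tops n" "j < 3" "l < n"
  shows "q (e_unit n j l) \<in> even_tops n" "q (f_unit n j l) \<in> even_vectors n"
  using q_move[OF unit_in_int_vectors(1), of 0 j 0 l] q_move[OF unit_in_int_vectors(2), of 0 j 0 l]
    move_even q_e_unit[OF assms(1,3)] q_f_unit[OF assms(1,3)] assms by (auto simp: move_unit)

lemma difference_closed_vimage:
  assumes "difference_closed S"
  shows "difference_closed {x \<in> int_vectors n. q x \<in> S}"
  using assms by (auto simp: difference_closed_def q_0 q_diff int_vectors_0 int_vectors_diff)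

text \<open>
  As \<open>q\<close> maps everything to combinations of the \<open>f\<close>s modulo 2, and kills these, \<open>3 q = q\<^sup>2\<close> vanishes modulo 2.
\<close>
lemma even_if_first_unit_even:
  assumes first: "q (e_unit n 0 0) \<in> even_tops n" and x: "x \<in> int_vectors n"
  shows "q x \<in> even_vectors n"
proof -
  have tops: "q y \<in> even_tops n" if y: "y \<in> int_vectors n" for y
  proof -
    let ?S = "{x \<in> int_vectors n. q x \<in> even_tops n}"
    have S: "difference_closed ?S" by (intro difference_closed_vimage difference_closed_vectors)
    have "y \<in> ?S"
    proof (rule generated_by_units[OF S])
      show "y \<in> coord_space n" using y int_vectors_subset by blast
      fix j l :: nat assume jl: "j < 3" "l < n"
      have u: "e_unit n j l \<in> ?S" "f_unit n j l \<in> ?S"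
        using q_all_units[OF first jl] even_vectors_subset by (auto simp: unit_in_int_vectors)
      have r: "ecoord y j l \<in> \<int>" "fcoord y j l \<in> \<int>" using y jl by (simp_all add: int_vectors_iff)
      show "ecoord y j l *\<^sub>R e_unit n j l \<in> ?S" by (rule difference_closed_scaleR[OF S u(1) r(1)])
      show "fcoord y j l *\<^sub>R f_unit n j l \<in> ?S" by (rule difference_closed_scaleR[OF S u(2) r(2)])
    qed
    then show ?thesis by simp
  qed
  have even: "q y \<in> even_vectors n" if y: "y \<in> even_tops n" for y
  proof -
    let ?S = "{x \<in> int_vectors n. q x \<in> even_vectors n}"
    have S: "difference_closed ?S" by (intro difference_closed_vimage difference_closed_vectors)
    have yi: "y \<in> int_vectors n" using y by (simp add: even_tops_def)
    have "y \<in> ?S"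
    proof (rule generated_by_units[OF S])
      show "y \<in> coord_space n" using yi int_vectors_subset by blast
      fix j l :: nat assume jl: "j < 3" "l < n"
      have "2 *\<^sub>R e_unit n j l \<in> ?S"
        by (simp add: int_vectors_scaleR unit_in_int_vectors q_even twice_even)
      moreover have "ecoord y j l / 2 \<in> \<int>" using y jl by (simp add: even_tops_def)
      ultimately have "(ecoord y j l / 2) *\<^sub>R (2 *\<^sub>R e_unit n j l) \<in> ?S"
        by (rule difference_closed_scaleR[OF S])
      then show "ecoord y j l *\<^sub>R e_unit n j l \<in> ?S" by simp
      have "f_unit n j l \<in> ?S"
        using q_all_units[OF first jl] by (simp add: unit_in_int_vectors)
      moreover have "fcoord y j l \<in> \<int>" using yi jl by (simp add: int_vectors_iff)
      ultimately show "fcoord y j l *\<^sub>R f_unit n j l \<in> ?S" by (rule difference_closed_scaleR[OF S])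
    qed
    then show ?thesis by simp
  qed
  have "3 *\<^sub>R q x \<in> even_vectors n"
    using even[OF tops[OF x]] q_q[OF x] by simp
  moreover have "2 *\<^sub>R q x \<in> even_vectors n" by (intro twice_even q_int x)
  moreover have "q x = 3 *\<^sub>R q x - 2 *\<^sub>R q x" by (simp flip: scaleR_diff_left)
  ultimately show ?thesis using difference_closed_vectors(2) by (metis difference_closed_def)
qed

end

lemma quasi_projection_complement:
  assumes "quasi_projection n q"
  shows "quasi_projection n (\<lambda>x. 3 *\<^sub>R x - q x)"
proof -
  interpret quasi_projection n q by fact
  have q3: "q (3 *\<^sub>R x) = 3 *\<^sub>R q x" if "x \<in> int_vectors n" for x
  proof -
    have eq: "3 *\<^sub>R y = y + (y + y)" for y :: vector
      by (rule vector_eqI; simp only: coord_simps; simp)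
    have "q (x + (x + x)) = q x + q (x + x)" by (rule q_add[OF that int_vectors_add[OF that that]])
    then show ?thesis unfolding eq q_add[OF that that] .
  qed
  have i3: "3 *\<^sub>R x \<in> int_vectors n" if "x \<in> int_vectors n" for x
    using that by (simp add: int_vectors_scaleR)
  show ?thesis
  proof
    fix x assume x: "x \<in> int_vectors n"
    then show "3 *\<^sub>R x - q x \<in> int_vectors n" by (intro int_vectors_diff i3 q_int)
    show "3 *\<^sub>R (x + y) - q (x + y) = 3 *\<^sub>R x - q x + (3 *\<^sub>R y - q y)" if "y \<in> int_vectors n" for y
      using x that by (simp add: q_add scaleR_right_distrib)
    show "3 *\<^sub>R move n v i x - q (move n v i x) = move n v i (3 *\<^sub>R x - q x)" if "v < 4" "i < 3" for v i
      using q_move[OF x that] move_add[of n v i "3 *\<^sub>R x - q x" "q x"] by (simp add: move_scaleR)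
    show "3 *\<^sub>R (3 *\<^sub>R x - q x) - q (3 *\<^sub>R x - q x) = 3 *\<^sub>R (3 *\<^sub>R x - q x)"
      using x by (simp add: q_diff i3 q_int q3 q_q)
  qed
qed

text \<open>
  The image of \<open>e\<^sub>0\<close> under \<open>q\<close> is congruent to 0 or to \<open>e\<^sub>0\<close>; in the second case the complementary map \<open>3 - q\<close>
  kills it.
\<close>
lemma quasi_projection_trivial_mod_2:
  assumes "quasi_projection n q" "n > 0"
  shows "(\<forall>x\<in>int_vectors n. q x \<in> even_vectors n) \<or> (\<forall>x\<in>int_vectors n. 3 *\<^sub>R x - q x \<in> even_vectors n)"
proof -
  interpret quasi_projection n q by fact
  interpret c: quasi_projection n "\<lambda>x. 3 *\<^sub>R x - q x" by (rule quasi_projection_complement) fact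
  let ?u = "e_unit n 0 0"
  have u: "ecoord ?u 0 0 = 1" using assms(2) by (simp add: unit_coord)
  have qu: "q ?u \<in> int_vectors n" by (intro q_int unit_in_int_vectors)
  then have "ecoord (q ?u) 0 0 \<in> \<int>" by (simp add: int_vectors_iff)
  then obtain m :: int where m: "ecoord (q ?u) 0 0 = of_int m" by (auto elim: Ints_cases)
  show ?thesis
  proof (cases "even m")
    case True
    then have "ecoord (q ?u) 0 0 / 2 \<in> \<int>" using m by (auto elim!: evenE)
    then have "q ?u \<in> even_tops n"
      using even_tops_except_first qu q_first_unit_fixed_mod_2[OF assms(2)] by blast
    then show ?thesis using even_if_first_unit_even by blast
  next
    case False
    have "ecoord (3 *\<^sub>R ?u - q ?u) 0 0 / 2 = of_int ((3 - m) div 2)"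
      using False m u by (auto elim!: oddE)
    then have "ecoord (3 *\<^sub>R ?u - q ?u) 0 0 / 2 \<in> \<int>" by simp
    then have "3 *\<^sub>R ?u - q ?u \<in> even_tops n"
      using even_tops_except_first c.q_int[OF unit_in_int_vectors(1)] c.q_first_unit_fixed_mod_2[OF assms(2)] by blast
    then show ?thesis using c.even_if_first_unit_even by blast
  qed
qed

section \<open>Indecomposability\<close>
lemma eq_0_if_infinitely_even:
  assumes "\<And>b. b \<in> B \<Longrightarrow> \<exists>b'\<in>B. b = 2 *\<^sub>R b'" and "B \<subseteq> int_vectors n"
    and "b \<in> B"
  shows "b = 0"
proof (rule poly_mapping_eqI, rule ccontr)
  fix m
  let ?r = "Poly_Mapping.lookup b m"
  assume "Poly_Mapping.lookup b m \<noteq> Poly_Mapping.lookup 0 m"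
  then have nz: "?r \<noteq> 0" by simp
  have "\<exists>c\<in>B. b = 2 ^ k *\<^sub>R c" for k
  proof (induction k)
    case 0
    then show ?case using assms(3) by simp
  next
    case (Suc k)
    then obtain c c' where "c \<in> B" "b = 2 ^ k *\<^sub>R c" "c' \<in> B" "c = 2 *\<^sub>R c'"
      using assms(1) by blast
    then show ?case by (intro bexI[of _ c']) (simp_all add: mult.commute)
  qed
  moreover obtain k :: nat where k: "\<bar>?r\<bar> < 2 ^ k"
    using real_arch_pow[of 2 "\<bar>?r\<bar>"] by auto
  ultimately obtain c where c: "c \<in> B" "b = 2 ^ k *\<^sub>R c" by blast
  then have r: "?r = 2 ^ k * Poly_Mapping.lookup c m" by (simp add: lookup_scaleR)
  have "c \<in> int_vectors n" using c(1) assms(2) by blast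
  then have "Poly_Mapping.lookup c m \<in> \<int>" by (simp add: int_vectors_def)
  then obtain z :: int where z: "Poly_Mapping.lookup c m = of_int z" by (rule Ints_cases)
  have "z \<noteq> 0" using nz r z by auto
  then have "1 \<le> \<bar>of_int z :: real\<bar>" by linarith
  then have "2 ^ k * 1 \<le> 2 ^ k * \<bar>of_int z :: real\<bar>" by (intro mult_left_mono) simp_all
  then have "2 ^ k \<le> \<bar>?r\<bar>" using r z by (simp add: abs_mult)
  then show False using k by simp
qed

lemma half_in_crys_lattice:
  assumes "x \<in> crys_lattice n" "x \<in> even_vectors n"
  shows "(1 / 2) *\<^sub>R x \<in> crys_lattice n"
proof -
  let ?c = "(1 / 2) *\<^sub>R x"
  have c: "?c \<in> int_vectors n" using assms(2) by (simp add: even_vectors_def)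
  then have "weight ?c \<in> \<int>" by (simp add: weight_def int_vectors_iff del: coord_simps)
  moreover have "weight x / 3 \<in> \<int>" using assms(1) by (simp add: crys_lattice_def)
  ultimately have "weight ?c - weight x / 3 \<in> \<int>" by (rule Ints_diff)
  moreover have "weight ?c - weight x / 3 = weight ?c / 3" by simp
  ultimately show ?thesis using c unfolding crys_lattice_def by simp
qed

lemma submodule_simps:
  assumes "submodule G M act N"
  shows submodule_subset: "N \<subseteq> M" and submodule_0: "0 \<in> N"
    and submodule_diff: "x \<in> N \<Longrightarrow> y \<in> N \<Longrightarrow> x - y \<in> N"
    and submodule_act: "g \<in> carrier G \<Longrightarrow> x \<in> N \<Longrightarrow> act g x \<in> N"
  using assms by (simp_all add: submodule_def)

lemma submodule_add: "submodule G M act N \<Longrightarrow> x \<in> N \<Longrightarrow> y \<in> N \<Longrightarrow> x + y \<in> N"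
  using submodule_diff[of G M act N x "0 - y"] submodule_diff[of G M act N 0 y] submodule_0[of G M act N] by simp

text \<open>
  Halving an element of such a summand stays in the lattice, because 2 is prime to the index 3, and then
  in the summand, because the complement is torsion-free.  So the summand is 2-divisible.
\<close>
lemma summand_eq_0_if_even:
  assumes A: "submodule G (crys_lattice n) act A" and B: "submodule G (crys_lattice n) act B"
    and sum: "A + B = crys_lattice n" and int: "A \<inter> B = {0}"
    and even: "B \<subseteq> even_vectors n"
  shows "B = {0}"
proof -
  have "\<exists>b'\<in>B. b = 2 *\<^sub>R b'" if b: "b \<in> B" for b
  proof -
    have "b \<in> crys_lattice n" "b \<in> even_vectors n" using submodule_subset[OF B] even b by auto
    then have "(1 / 2) *\<^sub>R b \<in> A + B" unfolding sum by (rule half_in_crys_lattice)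
    then obtain a b' where ab: "a \<in> A" "b' \<in> B" "(1 / 2) *\<^sub>R b = a + b'" by (rule set_plus_elim) blast
    have diff: "a - (0 - a) \<in> A" "b - b' - b' \<in> B"
      by (intro submodule_diff[OF A] submodule_diff[OF B] submodule_0[OF A] ab b)+
    have "b = 2 *\<^sub>R ((1 / 2) *\<^sub>R b)" by simp
    then have b2: "b = a + b' + (a + b')" unfolding ab(3) by (simp only: scaleR_2)
    then have "a - (0 - a) = b - b' - b'" by simp
    then have "a - (0 - a) \<in> A \<inter> B" using diff by (simp only: Int_iff)
    then have "a - (0 - a) = 0" unfolding int by (rule singletonD)
    moreover have "a - (0 - a) = 2 *\<^sub>R a" by (rule vector_eqI; simp only: coord_simps; simp)
    ultimately have "a = 0" by (simp only: scaleR_eq_0_iff) simp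
    then have "b = 2 *\<^sub>R b'" using b2 by (simp only: scaleR_2 add_0)
    then show ?thesis using ab(2) by blast
  qed
  moreover have "B \<subseteq> int_vectors n" using submodule_subset[OF B] crys_lattice_subset by (rule subset_trans)
  ultimately have "b = 0" if "b \<in> B" for b using that by (rule eq_0_if_infinitely_even)
  then show ?thesis using submodule_0[OF B] by auto
qed

lemma even_if_triple_even: "x \<in> int_vectors n \<Longrightarrow> 3 *\<^sub>R x \<in> even_vectors n \<Longrightarrow> x \<in> even_vectors n"
proof -
  assume x: "x \<in> int_vectors n" "3 *\<^sub>R x \<in> even_vectors n"
  then have "3 *\<^sub>R x - 2 *\<^sub>R x \<in> even_vectors n"
    using twice_even difference_closed_vectors(2)[of n] unfolding difference_closed_def by blast
  moreover have "3 *\<^sub>R x - 2 *\<^sub>R x = x" unfolding scaleR_left_diff_distrib[symmetric] by simp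
  ultimately show ?thesis by simp
qed

lemma indecomposable_crys:
  assumes "n > 0"
  shows "indecomposable_module (alt_group 4) (crys_lattice n) (crys_act n)"
  unfolding indecomposable_module_def
proof (intro conjI allI impI)
  let ?M = "crys_lattice n" and ?L = "int_vectors n"
  have "basis_vector 0 \<in> ?M"
    unfolding crys_lattice_eq_int_span[OF assms]
    using int_span_superset[OF finite_lattice_basis, of n] assms by (auto simp: lattice_basis_def)
  moreover have "basis_vector 0 \<noteq> 0"
    using lookup_basis_vector[of 0 0] by auto
  ultimately show "?M \<noteq> {0}" by blast
next
  let ?M = "crys_lattice n" and ?L = "int_vectors n"
  fix A B
  assume A: "submodule (alt_group 4) ?M (crys_act n) A" and B: "submodule (alt_group 4) ?M (crys_act n) B"
    and sum: "A + B = ?M" and int: "A \<inter> B = {0}"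
  note Ad = submodule_diff[OF A] and Bd = submodule_diff[OF B]
    and Aa = submodule_add[OF A] and Ba = submodule_add[OF B]
    and A0 = submodule_0[OF A] and B0 = submodule_0[OF B]
    and AM = submodule_subset[OF A] and BM = submodule_subset[OF B]
  have Am: "move n v i x \<in> A" if "x \<in> A" "v < 4" "i < 3" for x v i
    using submodule_act[OF A affine_perm_in_carrier[OF that(2,3)] that(1)] by (simp only: crys_act that)
  have Bm: "move n v i x \<in> B" if "x \<in> B" "v < 4" "i < 3" for x v i
    using submodule_act[OF B affine_perm_in_carrier[OF that(2,3)] that(1)] by (simp only: crys_act that)
  \<comment> \<open>The projection onto \<open>B\<close> along \<open>A\<close>.\<close>
  define p where "p x = (THE b. b \<in> B \<and> x - b \<in> A)" for x
  have p: "p x = b" if "b \<in> B" "x - b \<in> A" for x b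
    unfolding p_def
  proof (rule the_equality)
    show "b \<in> B \<and> x - b \<in> A" using that by blast
    fix b' assume b': "b' \<in> B \<and> x - b' \<in> A"
    then have "b' - b \<in> B" using that(1) by (intro Bd) auto
    moreover have "(x - b) - (x - b') \<in> A" by (rule Ad[OF that(2) conjunct2[OF b']])
    moreover have "(x - b) - (x - b') = b' - b" by (rule vector_eqI; simp only: coord_simps; simp)
    ultimately have "b' - b \<in> A \<inter> B" by (simp only: Int_iff)
    then have "b' - b = 0" unfolding int by (rule singletonD)
    then show "b' = b" by simp
  qed
  have pM: "p x \<in> B" "x - p x \<in> A" if "x \<in> ?M" for x
  proof -
    have "x \<in> A + B" using that unfolding sum .
    then obtain a b where "a \<in> A" "b \<in> B" "x = a + b" by (rule set_plus_elim) blast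
    moreover from this have "p x = b" by (intro p) simp_all
    ultimately show "p x \<in> B" "x - p x \<in> A" by simp_all
  qed
  define q where "q x = p (3 *\<^sub>R x)" for x
  have three: "3 *\<^sub>R x \<in> ?M" if "x \<in> ?L" for x
  proof -
    have "weight (3 *\<^sub>R x) / 3 = weight x" by simp
    moreover have "weight x \<in> \<int>" using that by (simp add: weight_def int_vectors_iff)
    moreover have "3 *\<^sub>R x \<in> ?L" using that by (intro int_vectors_scaleR) simp_all
    ultimately show ?thesis unfolding crys_lattice_def by simp
  qed
  have "quasi_projection n q"
  proof
    fix x assume x: "x \<in> ?L"
    note qx = pM[OF three[OF x], folded q_def]
    show qL: "q x \<in> ?L" using qx BM crys_lattice_subset by blast
    show "q (x + y) = q x + q y" if "y \<in> ?L" for y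
    proof -
      note qy = pM[OF three[OF that], folded q_def]
      have "(3 *\<^sub>R x - q x) + (3 *\<^sub>R y - q y) \<in> A" using qx qy by (intro Aa)
      moreover have "(3 *\<^sub>R x - q x) + (3 *\<^sub>R y - q y) = 3 *\<^sub>R (x + y) - (q x + q y)"
        unfolding scaleR_right_distrib by (rule vector_eqI; simp)
      ultimately show ?thesis unfolding q_def[of "x + y"] using qx qy by (intro p Ba) simp_all
    qed
    show "q (move n v i x) = move n v i (q x)" if "v < 4" "i < 3" for v i
    proof -
      have "move n v i (3 *\<^sub>R x - q x) \<in> A" using qx that by (intro Am)
      moreover have "move n v i (3 *\<^sub>R x - q x) = 3 *\<^sub>R move n v i x - move n v i (q x)"
        unfolding move_scaleR[symmetric] using move_add[of n v i "3 *\<^sub>R x - q x" "q x"] by simp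
      ultimately show ?thesis unfolding q_def[of "move n v i x"] using qx that by (intro p Bm) simp_all
    qed
    show "q (q x) = 3 *\<^sub>R q x"
    proof -
      have "q x + (q x + q x) \<in> B" using qx by (intro Ba)
      moreover have "q x + (q x + q x) = 3 *\<^sub>R q x" by (rule vector_eqI; simp only: coord_simps; simp)
      ultimately show ?thesis unfolding q_def[of "q x"] using A0 by (intro p) simp_all
    qed
  qed
  from quasi_projection_trivial_mod_2[OF this assms]
  show "A = {0} \<or> B = {0}"
  proof
    assume even: "\<forall>x\<in>?L. q x \<in> even_vectors n"
    have "B \<subseteq> even_vectors n"
    proof
      fix b assume b: "b \<in> B"
      then have bL: "b \<in> ?L" using BM crys_lattice_subset by blast
      have "b + (b + b) \<in> B" using b by (intro Ba)
      moreover have "b + (b + b) = 3 *\<^sub>R b" by (rule vector_eqI; simp only: coord_simps; simp)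
      ultimately have "q b = 3 *\<^sub>R b" unfolding q_def using A0 by (intro p) simp_all
      then show "b \<in> even_vectors n" using even bL even_if_triple_even by metis
    qed
    then show ?thesis using summand_eq_0_if_even[OF A B sum int] by blast
  next
    assume even: "\<forall>x\<in>?L. 3 *\<^sub>R x - q x \<in> even_vectors n"
    have "A \<subseteq> even_vectors n"
    proof
      fix a assume a: "a \<in> A"
      then have aL: "a \<in> ?L" using AM crys_lattice_subset by blast
      have "a + (a + a) \<in> A" using a by (intro Aa)
      moreover have "a + (a + a) = 3 *\<^sub>R a" by (rule vector_eqI; simp only: coord_simps; simp)
      ultimately have "q a = 0" unfolding q_def using B0 by (intro p) simp_all
      then have "3 *\<^sub>R a \<in> even_vectors n" using even aL by (metis diff_0_right)
      then show "a \<in> even_vectors n" using aL even_if_triple_even by blast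
    qed
    moreover have "B + A = ?M" "B \<inter> A = {0}" using sum int by (simp_all add: add.commute Int_commute)
    ultimately show ?thesis using summand_eq_0_if_even[OF B A] by blast
  qed
qed

section \<open>An infinite family\<close>
lemma rank_le_if_iso:
  assumes "odd n" "odd m"
    and "Crys (alt_group 4) (crys_act n) (crys_cocycle n) \<cong> Crys (alt_group 4) (crys_act m) (crys_cocycle m)"
  shows "m \<le> n"
proof -
  have "n > 0" "m > 0" using assms(1,2) by (auto intro: odd_pos)
  then have "card (lattice_basis m) \<le> card (lattice_basis n)"
    using crystallographic_crys[OF assms(1)] crystallographic_crys[OF assms(2)] assms(3)
    by (intro iso_imp_rank_le[where G = "alt_group 4" and H = "alt_group 4"])
      (simp_all add: finite_lattice_basis independent_lattice_basis crys_lattice_eq_int_span)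
  then show ?thesis by (simp add: card_lattice_basis)
qed

theorem theorem3:
  shows "\<exists>\<G> :: ((nat \<Rightarrow> nat) \<times> (nat \<Rightarrow>\<^sub>0 real)) monoid set.
    infinite \<G> \<and>
    (\<forall>\<Gamma>\<in>\<G>. indecomposable_crystallographic_group (alt_group 4) \<Gamma> \<and> torsionfree \<Gamma>) \<and>
    (\<forall>\<Gamma>\<in>\<G>. \<forall>\<Delta>\<in>\<G>. \<Gamma> \<noteq> \<Delta> \<longrightarrow> \<not> \<Gamma> \<cong> \<Delta>)"
proof -
  define \<Gamma> where "\<Gamma> k = Crys (alt_group 4) (crys_act (2 * k + 1)) (crys_cocycle (2 * k + 1))" for k
  have odd: "odd (2 * k + 1)" for k :: nat by simp
  have group: "group (\<Gamma> k)" for k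
    unfolding \<Gamma>_def by (rule crystallographic.group_\<Gamma>[OF crystallographic_crys[OF odd]])
  have "\<Gamma> k \<cong> \<Gamma> m \<Longrightarrow> m \<le> k" for k m
    using rank_le_if_iso[OF odd odd, of k m] unfolding \<Gamma>_def by simp
  then have distinct: "k = m" if "\<Gamma> k \<cong> \<Gamma> m" for k m
    using that group.iso_sym[OF group that] by (simp add: le_antisym)
  then have "inj \<Gamma>" by (metis injI iso_refl)
  then have "infinite (range \<Gamma>)" by (rule range_inj_infinite)
  moreover have "indecomposable_crystallographic_group (alt_group 4) (\<Gamma> k) \<and> torsionfree (\<Gamma> k)" for k
  proof
    show "torsionfree (\<Gamma> k)" unfolding \<Gamma>_def by (rule torsionfree_crys[OF odd])
    show "indecomposable_crystallographic_group (alt_group 4) (\<Gamma> k)"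
      unfolding indecomposable_crystallographic_group_def \<Gamma>_def
      by (intro exI conjI, rule faithful_lattice_module_crys[OF odd_pos[OF odd]], rule cocycle_crys[OF odd],
          rule refl, rule iso_refl, rule not_coboundary_crys[OF odd], rule indecomposable_crys[OF odd_pos[OF odd]])
  qed
  moreover have "\<Gamma>' \<noteq> \<Delta> \<longrightarrow> \<not> \<Gamma>' \<cong> \<Delta>" if "\<Gamma>' \<in> range \<Gamma>" "\<Delta> \<in> range \<Gamma>" for \<Gamma>' \<Delta>
    using that distinct by blast
  ultimately show ?thesis by (intro exI[of _ "range \<Gamma>"]) blast
qed

end
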